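(* Let $p\ge 2$ be a fixed integer. Then, as $x\to\infty$, $$\sum_{i,j\le x}((i,j)^{\ast})^p=C^{\ast}_p\,x^{p+1}+O(E^{\ast}_p(x)),$$ where $$C^{\ast}_p:=\frac{\zeta(p+1)}{p+1}\,D^{\ast}_p\sum_{n=1}^{\infty}\frac{(n-1)g_p(n)+G_p(n)}{n^{p+1}},$$ $$D^{\ast}_p:=\prod_{q}\left(1-\frac2{q^{p+1}}+\frac1{q^{p+2}}\right)$$ (the product being over all primes $q$), $$g_p(n)=\prod_{q\mid n}\left(1-\frac1{q}\right)\left(1-\frac1{q^{p+1}}\right)\left(1-\frac2{q^{p+1}}+\frac1{q^{p+2}}\right)^{-1}$$ (the product being over the prime divisors $q$ of $n$), $$G_p(n)=\sum_{k=1}^n g_p(k),$$ and $E^{\ast}_p(x)=x^p$ for $p>2$ and $E^{\ast}_2(x)=x^2(\log x)^2$.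
   Context: A positive divisor $d$ of a positive integer $n$ is a unitary divisor of $n$ if $\gcd(d,n/d)=1$. For positive integers $i,j$, $(i,j)^{\ast}$ (the semi-unitary greatest common divisor) is the greatest divisor of $i$ which is a unitary divisor of $j$. The sum is over all ordered pairs of positive integers $i,j\le x$, and $\zeta$ is the Riemann zeta function. The implied constant may depend on $p$. *)

theory Defs
  imports
    "HOL-Analysis.Analysis"
    "HOL-Computational_Algebra.Primes"
    "HOL-Library.Landau_Symbols"
begin

definition unitary_divisor :: "nat \<Rightarrow> nat \<Rightarrow> bool" where
  "unitary_divisor d n \<longleftrightarrow> d dvd n \<and> coprime d (n div d)"

(* Meaningful for positive i and j only: the set then contains 1 and is bounded by i. *)
definition semi_unitary_gcd :: "nat \<Rightarrow> nat \<Rightarrow> nat" where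
  "semi_unitary_gcd i j = Max {d. d dvd i \<and> unitary_divisor d j}"

(* The Riemann zeta function at real s > 1, where its Dirichlet series converges. *)
definition zeta :: "real \<Rightarrow> real" where
  "zeta s = (\<Sum>n. 1 / real (Suc n) powr s)"

definition semi_unitary_power_sum :: "nat \<Rightarrow> real \<Rightarrow> real" where
  "semi_unitary_power_sum p x =
     (\<Sum>(i, j) \<in> {(i::nat, j::nat). 1 \<le> i \<and> 1 \<le> j \<and> real i \<le> x \<and> real j \<le> x}.
        real (semi_unitary_gcd i j) ^ p)"

(* The product over all primes is taken in increasing order, with factor 1 at non-primes. *)
definition D_star :: "nat \<Rightarrow> real" where
  "D_star p =
     (\<Prod>q. if prime q then 1 - 2 / real q ^ (p + 1) + 1 / real q ^ (p + 2) else 1)"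

definition g :: "nat \<Rightarrow> nat \<Rightarrow> real" where
  "g p n = (\<Prod>q \<in> prime_factors n.
     (1 - 1 / real q) * (1 - 1 / real q ^ (p + 1))
       * inverse (1 - 2 / real q ^ (p + 1) + 1 / real q ^ (p + 2)))"

definition G :: "nat \<Rightarrow> nat \<Rightarrow> real" where
  "G p n = (\<Sum>k = 1..n. g p k)"

(* The series starts at 1; its index is shifted so that the term of index m is that of n = m + 1. *)
definition C_star :: "nat \<Rightarrow> real" where
  "C_star p = zeta (real p + 1) / (real p + 1) * D_star p *
     (\<Sum>m. let n = Suc m in ((real n - 1) * g p n + G p n) / real n ^ (p + 1))"

definition E_star :: "nat \<Rightarrow> real \<Rightarrow> real" where
  "E_star p x = (if p = 2 then x ^ 2 * (ln x) ^ 2 else x ^ p)"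

end

theory Submission
  imports Defs
begin

text \<open>
  Unitary divisors of \<open>n\<close> correspond to sets of prime divisors of \<open>n\<close>, so expanding
  \<open>n ^ p = \<Prod>((q ^ v) ^ p - 1 + 1)\<close> over the prime powers exactly dividing \<open>n\<close> gives
  \<open>n ^ p = \<Sum> J d\<close> over the unitary divisors \<open>d\<close> of \<open>n\<close>, where \<open>J\<close> is the unitary Jordan
  function. The divisors of \<open>i\<close> that are unitary divisors of \<open>j\<close> are precisely the unitary
  divisors of the semi-unitary gcd of \<open>i\<close> and \<open>j\<close>
  (\<open>common_unitary_divisors\<close>). Writing \<open>i = d * a\<close>, \<open>j = d * b\<close> therefore turns the sum into

    \<open>\<Sum>a,b \<le> x. F b (x / max a b)\<close> with \<open>F b y = \<Sum> {J d | d \<le> y, coprime d b}\<close>.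

  To evaluate \<open>F b y\<close>, expand \<open>J d\<close> once more, as a signed sum of \<open>(d / e) ^ p\<close> over the unitary
  divisors \<open>e\<close> of \<open>d\<close>. What remains is a sum of \<open>k ^ p\<close> over the \<open>k \<le> y / e\<close> that avoid the primes
  of \<open>e * b\<close>; sieving one prime after the other evaluates it with an error \<open>2 ^ omega (e * b)\<close>
  times \<open>(y / e) ^ p\<close> (\<open>coprime_power_sum_asymptotic\<close>). Summing over \<open>e\<close> yields
  \<open>F b y = \<kappa> * g p b * y ^ (p + 1) + O(2 ^ omega b * y ^ p)\<close>
  (\<open>coprime_jordan_sum_asymptotic\<close>); the constant is an absolutely convergent sum of a multiplicative
  function, and comparing Euler factors identifies it as \<open>\<kappa> * g p b\<close> with
  \<open>\<kappa> = zeta (p + 1) / (p + 1) * D_star p\<close> (\<open>sieve_coeff_suminf\<close>).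

  Finally \<open>y = x / max a b\<close> is inserted. Sorting the pairs by \<open>n = max a b\<close> turns the main
  terms into a partial sum of the series defining \<open>C_star p\<close>, whose tail beyond \<open>x\<close> contributes
  \<open>O(x ^ 2)\<close>. In the error term the sum over \<open>a\<close> of \<open>1 / max a b ^ p\<close> is at most
  \<open>2 / b ^ (p - 1)\<close>, and bounding \<open>2 ^ omega b\<close> by the number of divisors of \<open>b\<close> leaves
  \<open>x ^ p\<close> times the square of \<open>\<Sum>k \<le> x. 1 / k ^ (p - 1)\<close>. That sum is bounded for \<open>p > 2\<close> and is
  \<open>O(ln x)\<close> for \<open>p = 2\<close>, which accounts for the two shapes of the error term.
\<close>

section \<open>Euler products\<close>

definition smooth_numbers :: "nat set \<Rightarrow> nat set" where
  "smooth_numbers P = {n. 0 < n \<and> prime_factors n \<subseteq> P}"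

text \<open>
  Splitting off the full power of one prime is what lets a multiplicative sum over smooth numbers
  be computed prime by prime.
\<close>

lemma bij_betw_smooth_numbers_insert:
  fixes q :: nat
  assumes q: "prime q" and "q \<notin> P"
  shows "bij_betw (\<lambda>(m, a). m * q ^ a) (smooth_numbers P \<times> UNIV) (smooth_numbers (insert q P))"
proof (rule bij_betw_byWitness[where f' = "\<lambda>n. (n div q ^ multiplicity q n, multiplicity q n)"])
  have q0: "q > 0" and q1: "\<not> is_unit q"
    using q by (auto simp: prime_gt_0_nat)
  have pf: "prime_factors (q ^ a) \<subseteq> {q}" for a
    using q by (cases "a = 0") (auto simp: prime_factorization_prime_power)
  show "\<forall>z\<in>smooth_numbers P \<times> UNIV.
      (\<lambda>n. (n div q ^ multiplicity q n, multiplicity q n)) ((\<lambda>(m, a). m * q ^ a) z) = z"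
  proof (intro ballI)
    fix z assume "z \<in> smooth_numbers P \<times> (UNIV :: nat set)"
    then obtain m a where z: "z = (m, a)" and m: "m \<in> smooth_numbers P" by auto
    then have "\<not> q dvd m"
      using assms by (auto simp: smooth_numbers_def prime_factors_dvd)
    then have "multiplicity q (m * q ^ a) = a"
      using m q q0 q1 by (simp add: smooth_numbers_def prime_elem_multiplicity_mult_distrib
          not_dvd_imp_multiplicity_0)
    then show "(\<lambda>n. (n div q ^ multiplicity q n, multiplicity q n)) ((\<lambda>(m, a). m * q ^ a) z) = z"
      using q0 by (simp add: z)
  qed
  show "\<forall>n\<in>smooth_numbers (insert q P).
      (\<lambda>(m, a). m * q ^ a) (n div q ^ multiplicity q n, multiplicity q n) = n"
    by (simp add: multiplicity_dvd)
  show "(\<lambda>(m, a). m * q ^ a) ` (smooth_numbers P \<times> UNIV) \<subseteq> smooth_numbers (insert q P)"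
  proof clarify
    fix m a assume m: "m \<in> smooth_numbers P"
    then have "prime_factors (m * q ^ a) = prime_factors m \<union> prime_factors (q ^ a)"
      using q0 by (intro prime_factors_product) (auto simp: smooth_numbers_def)
    then show "m * q ^ a \<in> smooth_numbers (insert q P)"
      using m pf[of a] q0 by (auto simp: smooth_numbers_def)
  qed
  show "(\<lambda>n. (n div q ^ multiplicity q n, multiplicity q n)) ` smooth_numbers (insert q P)
      \<subseteq> smooth_numbers P \<times> UNIV"
  proof clarify
    fix n assume n: "n \<in> smooth_numbers (insert q P)"
    define m where "m = n div q ^ multiplicity q n"
    have eq: "n = m * q ^ multiplicity q n"
      by (simp add: m_def multiplicity_dvd)
    have n0: "n > 0" using n by (simp add: smooth_numbers_def)
    have "\<not> q dvd m"
      using multiplicity_decompose[of n q] n0 q1 by (simp add: m_def)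
    moreover have "prime_factors m \<subseteq> prime_factors n"
      using n0 eq by (metis dvd_prime_factors dvd_triv_left less_numeral_extra(3))
    moreover have "m > 0" using eq n0 by (metis mult_0 gr0I)
    moreover have "q \<notin> prime_factors m"
      using \<open>\<not> q dvd m\<close> by auto
    ultimately have "m \<in> smooth_numbers P"
      using n unfolding smooth_numbers_def by blast
    then show "n div q ^ multiplicity q n \<in> smooth_numbers P \<and> multiplicity q n \<in> UNIV"
      by (simp add: m_def)
  qed
qed

lemma infsum_smooth_numbers:
  fixes f :: "nat \<Rightarrow> real"
  assumes "finite P" and "\<And>q. q \<in> P \<Longrightarrow> prime q"
    and f1: "f 1 = 1" and mult: "\<And>m n. coprime m n \<Longrightarrow> f (m * n) = f m * f n"
    and sum: "f summable_on UNIV"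
  shows "infsum f (smooth_numbers P) = (\<Prod>q\<in>P. \<Sum>\<^sub>\<infinity>a. f (q ^ a))"
  using assms(1,2)
proof (induction P rule: finite_induct)
  case empty
  have "smooth_numbers {} = {1}"
    by (auto simp: smooth_numbers_def prime_factorization_empty_iff)
  then show ?case using f1 by simp
next
  case (insert q P)
  have q: "prime q" using insert by auto
  note bij = bij_betw_smooth_numbers_insert[OF q insert.hyps(2)]
  have eq: "f ((\<lambda>(m, a). m * q ^ a) z) = (\<lambda>(m, a). f m * f (q ^ a)) z"
    if z: "z \<in> smooth_numbers P \<times> UNIV" for z
  proof -
    obtain m a where [simp]: "z = (m, a)" by (cases z)
    have "\<not> q dvd m"
      using z insert.hyps(2) q by (auto simp: smooth_numbers_def prime_factors_dvd)
    then have "coprime m (q ^ a)"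
      using q by (metis coprime_commute coprime_power_left_iff prime_imp_coprime)
    then show ?thesis by (simp add: mult)
  qed
  have "(\<lambda>z. f ((\<lambda>(m, a). m * q ^ a) z)) summable_on smooth_numbers P \<times> UNIV"
    using summable_on_reindex_bij_betw[OF bij, of f] summable_on_subset_banach[OF sum] by blast
  then have sm: "(\<lambda>(m, a). f m * f (q ^ a)) summable_on smooth_numbers P \<times> UNIV"
    using eq by (subst (asm) summable_on_cong) auto
  have "infsum f (smooth_numbers (insert q P))
      = infsum (\<lambda>z. f ((\<lambda>(m, a). m * q ^ a) z)) (smooth_numbers P \<times> UNIV)"
    by (rule infsum_reindex_bij_betw[OF bij, symmetric])
  also have "\<dots> = infsum (\<lambda>(m, a). f m * f (q ^ a)) (smooth_numbers P \<times> UNIV)"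
    by (rule infsum_cong) (rule eq)
  also have "\<dots> = (\<Sum>\<^sub>\<infinity>m\<in>smooth_numbers P. \<Sum>\<^sub>\<infinity>a. f m * f (q ^ a))"
    by (rule infsum_Sigma'_banach[OF sm, symmetric])
  also have "\<dots> = infsum f (smooth_numbers P) * (\<Sum>\<^sub>\<infinity>a. f (q ^ a))"
    by (simp add: infsum_cmult_right' infsum_cmult_left')
  finally show ?case
    using insert by (simp add: mult.commute)
qed

text \<open>
  The product over the primes up to \<open>N\<close> is the sum over the positive integers all of whose prime
  factors are at most \<open>N\<close>. This set contains \<open>1, \<dots>, N\<close>, so the product differs from the full sum by
  at most the tail of the absolute values beyond \<open>N\<close>.
\<close>

theorem euler_product_tendsto:
  fixes f :: "nat \<Rightarrow> real"
  assumes f0: "f 0 = 0" and f1: "f 1 = 1"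
    and mult: "\<And>m n. coprime m n \<Longrightarrow> f (m * n) = f m * f n"
    and sum: "f summable_on UNIV"
  shows "(\<lambda>N. \<Prod>q | prime q \<and> q \<le> N. \<Sum>\<^sub>\<infinity>a. f (q ^ a)) \<longlonglongrightarrow> infsum f UNIV"
proof -
  let ?P = "\<lambda>N. {q. prime q \<and> q \<le> N}"
  have abs: "(\<lambda>n. \<bar>f n\<bar>) summable_on A" for A
    using summable_on_subset_banach[OF sum, of A] summable_on_iff_abs_summable_on_real[of f A]
    by simp
  have bound: "\<bar>(\<Prod>q\<in>?P N. \<Sum>\<^sub>\<infinity>a. f (q ^ a)) - infsum f UNIV\<bar>
      \<le> infsum (\<lambda>n. \<bar>f n\<bar>) UNIV - (\<Sum>n\<le>N. \<bar>f n\<bar>)" for N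
  proof -
    have fin: "finite (?P N)" by (rule finite_subset[of _ "{..N}"]) auto
    have "(\<Prod>q\<in>?P N. \<Sum>\<^sub>\<infinity>a. f (q ^ a)) = infsum f (smooth_numbers (?P N))"
      by (rule infsum_smooth_numbers[symmetric]) (use fin f1 mult sum in auto)
    then have "(\<Prod>q\<in>?P N. \<Sum>\<^sub>\<infinity>a. f (q ^ a)) - infsum f UNIV
        = - infsum f (UNIV - smooth_numbers (?P N))"
      using infsum_Diff[of f UNIV "smooth_numbers (?P N)"] sum summable_on_subset_banach[OF sum]
      by simp
    then have "\<bar>(\<Prod>q\<in>?P N. \<Sum>\<^sub>\<infinity>a. f (q ^ a)) - infsum f UNIV\<bar>
        \<le> infsum (\<lambda>n. \<bar>f n\<bar>) (UNIV - smooth_numbers (?P N))"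
      using norm_infsum_bound[of f "UNIV - smooth_numbers (?P N)"] abs by simp
    also have "\<dots> \<le> infsum (\<lambda>n. \<bar>f n\<bar>) (UNIV - {..N})"
    proof (rule infsum_mono_neutral)
      fix n assume n: "n \<in> UNIV - smooth_numbers (?P N) - (UNIV - {..N})"
      then have nN: "n \<le> N" by auto
      have "n = 0"
      proof (rule ccontr)
        assume "n \<noteq> 0"
        then have "prime_factors n \<subseteq> ?P N"
          using nN by (auto simp: prime_factors_dvd dest: dvd_imp_le)
        with n \<open>n \<noteq> 0\<close> show False by (auto simp: smooth_numbers_def)
      qed
      then show "\<bar>f n\<bar> \<le> 0" by (simp add: f0)
    qed (use abs in auto)
    also have "\<dots> = infsum (\<lambda>n. \<bar>f n\<bar>) UNIV - (\<Sum>n\<le>N. \<bar>f n\<bar>)"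
      by (subst infsum_Diff) (use abs in auto)
    finally show ?thesis .
  qed
  have "(\<lambda>n. \<bar>f n\<bar>) sums infsum (\<lambda>n. \<bar>f n\<bar>) UNIV"
    by (rule has_sum_imp_sums) (use abs in auto)
  then have "(\<lambda>N. \<Sum>n\<le>N. \<bar>f n\<bar>) \<longlonglongrightarrow> infsum (\<lambda>n. \<bar>f n\<bar>) UNIV"
    by (simp add: sums_def_le)
  from tendsto_diff[OF tendsto_const this, of "infsum (\<lambda>n. \<bar>f n\<bar>) UNIV"]
  have tail: "(\<lambda>N. infsum (\<lambda>n. \<bar>f n\<bar>) UNIV - (\<Sum>n\<le>N. \<bar>f n\<bar>)) \<longlonglongrightarrow> 0"
    by simp
  show ?thesis
    by (rule LIM_zero_cancel, rule Lim_null_comparison[OF _ tail])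
      (simp only: real_norm_def bound eventually_True)
qed

section \<open>Unitary divisors and the unitary Jordan function\<close>

text \<open>
  The unitary analogue of Jordan's totient function: it is characterised by having \<open>n ^ p\<close> as its
  sum over the unitary divisors of \<open>n\<close> (\<open>power_eq_sum_unitary_jordan\<close>).
\<close>

definition unitary_jordan :: "nat \<Rightarrow> nat \<Rightarrow> real" where
  "unitary_jordan p n = (\<Prod>q\<in>prime_factors n. real (q ^ multiplicity q n) ^ p - 1)"

definition omega :: "nat \<Rightarrow> nat" where
  "omega n = card (prime_factors n)"

lemma unitary_divisor_gt_0:
  assumes "unitary_divisor d n" "n > 0"
  shows "d > 0" "n div d > 0"
  using assms by (auto simp: unitary_divisor_def elim!: dvdE)

lemma multiplicity_unitary_divisor:
  fixes q :: nat
  assumes "unitary_divisor d n" "n > 0" "q \<in> prime_factors d"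
  shows "multiplicity q d = multiplicity q n"
proof -
  have n: "n = d * (n div d)" and cop: "coprime d (n div d)"
    using assms(1) by (auto simp: unitary_divisor_def)
  have q: "prime q" "q dvd d" using assms(3) by auto
  have "\<not> q dvd n div d"
    using cop q by (meson coprime_common_divisor not_prime_unit)
  then have "multiplicity q (d * (n div d)) = multiplicity q d"
    using q unitary_divisor_gt_0[OF assms(1,2)]
    by (simp add: prime_elem_multiplicity_mult_distrib not_dvd_imp_multiplicity_0)
  then show ?thesis using n by simp
qed

lemma prime_factors_div_unitary_divisor:
  assumes "unitary_divisor d n" "n > 0"
  shows "prime_factors (n div d) = prime_factors n - prime_factors d"
proof -
  have n: "n = d * (n div d)" and cop: "coprime d (n div d)"
    using assms(1) by (auto simp: unitary_divisor_def)
  have "prime_factors (d * (n div d)) = prime_factors d \<union> prime_factors (n div d)"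
    using unitary_divisor_gt_0[OF assms] by (intro prime_factors_product) auto
  moreover have "prime_factors d \<inter> prime_factors (n div d) = {}"
    using cop by (auto dest: coprime_common_divisor not_prime_unit)
  ultimately show ?thesis using n by auto
qed

text \<open>
  A prime power exactly dividing \<open>n\<close> lies either wholly inside a unitary divisor or wholly outside
  it, so the set of primes inside determines the divisor.
\<close>

lemma bij_betw_prime_factors_unitary_divisors:
  assumes n: "n > 0"
  shows "bij_betw prime_factors {d. unitary_divisor d n} (Pow (prime_factors n))"
proof (rule bij_betw_byWitness[where f' = "\<lambda>X. \<Prod>q\<in>X. q ^ multiplicity q n"])
  let ?f = "\<lambda>X. \<Prod>q\<in>X. q ^ multiplicity q n"
  show "\<forall>d\<in>{d. unitary_divisor d n}. ?f (prime_factors d) = d"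
  proof clarify
    fix d assume d: "unitary_divisor d n"
    have "?f (prime_factors d) = (\<Prod>q\<in>prime_factors d. q ^ multiplicity q d)"
      using multiplicity_unitary_divisor[OF d n] by (intro prod.cong) auto
    also have "\<dots> = d"
      using unitary_divisor_gt_0[OF d n] by (subst prod_prime_factors) auto
    finally show "?f (prime_factors d) = d" .
  qed
  show "\<forall>X\<in>Pow (prime_factors n). prime_factors (?f X) = X"
  proof
    fix X assume "X \<in> Pow (prime_factors n)"
    then have X: "X \<subseteq> prime_factors n" and fin: "finite X"
      using finite_subset by auto
    have pos: "\<forall>q\<in>X. q > 0" using X by (auto intro: prime_gt_0_nat)
    have "prime_factors (?f X) = (\<Union>q\<in>X. prime_factors (q ^ multiplicity q n))"
      using prime_factors_prod[OF fin, of "\<lambda>q. q ^ multiplicity q n"] pos by (auto simp: image_iff)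
    also have "\<dots> = (\<Union>q\<in>X. {q})"
    proof (intro SUP_cong refl)
      fix q assume "q \<in> X"
      then have "prime q" "multiplicity q n > 0"
        using X by (auto simp: prime_factors_multiplicity)
      then show "prime_factors (q ^ multiplicity q n) = {q}"
        by (simp add: prime_factorization_prime_power)
    qed
    finally show "prime_factors (?f X) = X" by simp
  qed
  show "prime_factors ` {d. unitary_divisor d n} \<subseteq> Pow (prime_factors n)"
    using n dvd_prime_factors[of n] by (auto simp: unitary_divisor_def)
  show "?f ` Pow (prime_factors n) \<subseteq> {d. unitary_divisor d n}"
  proof clarify
    fix X assume X: "X \<subseteq> prime_factors n"
    have pos: "\<forall>q\<in>X. q > 0" using X by (auto intro: prime_gt_0_nat)
    have "?f (prime_factors n) = n"
      using n by (subst prod_prime_factors) auto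
    then have eq: "n = ?f X * ?f (prime_factors n - X)"
      using prod.subset_diff[OF X, of "\<lambda>q. q ^ multiplicity q n"] by (simp add: mult.commute)
    have "coprime (?f X) (?f (prime_factors n - X))"
    proof (intro prod_coprime_left prod_coprime_right)
      fix q r assume "q \<in> X" "r \<in> prime_factors n - X"
      then have "prime q" "prime r" "q \<noteq> r" using X by auto
      then show "coprime (q ^ multiplicity q n) (r ^ multiplicity r n)"
        by (simp add: primes_coprime)
    qed
    moreover have "?f X > 0" using pos by (intro prod_pos) auto
    ultimately show "unitary_divisor (?f X) n"
      by (subst eq) (auto simp: unitary_divisor_def)
  qed
qed

lemma finite_unitary_divisors: "n > 0 \<Longrightarrow> finite {d. unitary_divisor d n}"
  by (rule finite_subset[of _ "{d. d dvd n}"]) (auto simp: unitary_divisor_def)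

text \<open>
  Multiplying out a product of binomials over the primes of \<open>n\<close>, with each set of primes read as the
  unitary divisor that it determines. Both the unitary Jordan expansion of \<open>n ^ p\<close> and its inversion
  are instances.
\<close>

lemma prod_add_eq_sum_unitary_divisors:
  fixes u v :: "nat \<Rightarrow> real"
  assumes n: "n > 0"
  shows "(\<Prod>q\<in>prime_factors n. u q + v q)
    = (\<Sum>d | unitary_divisor d n. (\<Prod>q\<in>prime_factors d. u q) * (\<Prod>q\<in>prime_factors (n div d). v q))"
proof -
  have "(\<Prod>q\<in>prime_factors n. u q + v q)
      = (\<Sum>X\<in>Pow (prime_factors n). prod u X * prod v (prime_factors n - X))"
    by (rule prod_add) simp
  also have "\<dots> = (\<Sum>d | unitary_divisor d n.
      prod u (prime_factors d) * prod v (prime_factors n - prime_factors d))"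
    by (rule sum.reindex_bij_betw[OF bij_betw_prime_factors_unitary_divisors[OF n], symmetric])
  also have "\<dots> = (\<Sum>d | unitary_divisor d n.
      prod u (prime_factors d) * prod v (prime_factors (n div d)))"
    by (intro sum.cong) (simp_all add: prime_factors_div_unitary_divisor n)
  finally show ?thesis .
qed

lemma power_eq_prod_prime_factors:
  assumes "n > 0"
  shows "real n ^ p = (\<Prod>q\<in>prime_factors n. real (q ^ multiplicity q n) ^ p)"
proof -
  have "real n = real (\<Prod>q\<in>prime_factors n. q ^ multiplicity q n)"
    using assms by (subst prod_prime_factors) auto
  then show ?thesis by (simp only: of_nat_prod prod_power_distrib)
qed

lemma power_eq_sum_unitary_jordan:
  assumes n: "n > 0"
  shows "real n ^ p = (\<Sum>d | unitary_divisor d n. unitary_jordan p d)"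
proof -
  have "real n ^ p = (\<Prod>q\<in>prime_factors n. (real (q ^ multiplicity q n) ^ p - 1) + 1)"
    using power_eq_prod_prime_factors[OF n] by simp
  also have "\<dots> = (\<Sum>d | unitary_divisor d n. (\<Prod>q\<in>prime_factors d. real (q ^ multiplicity q n) ^ p - 1))"
    by (subst prod_add_eq_sum_unitary_divisors[OF n]) simp
  also have "\<dots> = (\<Sum>d | unitary_divisor d n. unitary_jordan p d)"
    unfolding unitary_jordan_def
    by (intro sum.cong prod.cong) (simp_all add: multiplicity_unitary_divisor n)
  finally show ?thesis .
qed

lemma unitary_jordan_eq_sum:
  assumes n: "n > 0"
  shows "unitary_jordan p n = (\<Sum>e | unitary_divisor e n. (-1) ^ omega e * real (n div e) ^ p)"
proof -
  have "unitary_jordan p n = (\<Prod>q\<in>prime_factors n. (-1) + real (q ^ multiplicity q n) ^ p)"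
    by (simp add: unitary_jordan_def)
  also have "\<dots> = (\<Sum>e | unitary_divisor e n. (\<Prod>q\<in>prime_factors e. -1) *
      (\<Prod>q\<in>prime_factors (n div e). real (q ^ multiplicity q n) ^ p))"
    by (rule prod_add_eq_sum_unitary_divisors[OF n])
  also have "\<dots> = (\<Sum>e | unitary_divisor e n. (-1) ^ omega e * real (n div e) ^ p)"
  proof (intro sum.cong refl)
    fix e assume "e \<in> {e. unitary_divisor e n}"
    then have e: "unitary_divisor e n" by simp
    have e': "unitary_divisor (n div e) n"
      using e n by (auto simp: unitary_divisor_def coprime_commute)
    have "(\<Prod>q\<in>prime_factors (n div e). real (q ^ multiplicity q n) ^ p)
        = (\<Prod>q\<in>prime_factors (n div e). real (q ^ multiplicity q (n div e)) ^ p)"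
      using multiplicity_unitary_divisor[OF e' n] by (intro prod.cong) auto
    also have "\<dots> = real (n div e) ^ p"
      using power_eq_prod_prime_factors unitary_divisor_gt_0(2)[OF e n] by metis
    finally show "(\<Prod>q\<in>prime_factors e. -1) *
        (\<Prod>q\<in>prime_factors (n div e). real (q ^ multiplicity q n) ^ p)
        = (-1) ^ omega e * real (n div e) ^ p"
      by (simp add: omega_def)
  qed
  finally show ?thesis .
qed

text \<open>
  The left side counts the unitary divisors. The divisor count on the right has the advantage of a
  double sum over pairs of factors (\<open>sum_divisor_count_le\<close>).
\<close>

lemma two_power_omega_le: 
  assumes "n > 0"
  shows "2 ^ omega n \<le> card {d. d dvd n}"
proof -
  have "2 ^ omega n = card {d. unitary_divisor d n}"
    using bij_betw_same_card[OF bij_betw_prime_factors_unitary_divisors[OF assms]]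
    by (simp add: omega_def card_Pow)
  also have "\<dots> \<le> card {d. d dvd n}"
    using assms by (intro card_mono) (auto simp: unitary_divisor_def)
  finally show ?thesis .
qed

lemma codivisor_dvd_codivisor:
  fixes a b n :: nat
  assumes "a dvd b" "b dvd n" "n > 0"
  shows "n div b dvd n div a"
proof -
  obtain c where c: "b = a * c" using assms(1) ..
  obtain k where k: "n = b * k" using assms(2) ..
  have "a > 0" "c > 0" using assms(3) by (auto simp: c k)
  then have "n div b = k" "n div a = c * k" by (auto simp: c k)
  then show ?thesis by simp
qed

text \<open>
  The divisors of \<open>i\<close> that are unitary divisors of \<open>j\<close> are closed under least common multiples, so
  each of them divides the greatest one, which is the semi-unitary gcd. This is what makes the
  semi-unitary gcd accessible to divisor sums.
\<close>

lemma common_unitary_divisors: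
  assumes i: "i > 0" and j: "j > 0"
  shows "{d. d dvd i \<and> unitary_divisor d j} = {d. unitary_divisor d (semi_unitary_gcd i j)}"
    and "semi_unitary_gcd i j > 0"
proof -
  let ?M = "{d. d dvd i \<and> unitary_divisor d j}"
  define m where "m = Max ?M"
  have fin: "finite ?M" using i by (rule_tac finite_subset[of _ "{d. d dvd i}"]) auto
  have "1 \<in> ?M" by (auto simp: unitary_divisor_def)
  then have "m \<in> ?M" unfolding m_def by (intro Max_in fin) auto
  then have m: "m dvd i" "m dvd j" "coprime m (j div m)" by (auto simp: unitary_divisor_def)
  have m0: "m > 0" using m(1) i by (auto intro: gr0I)
  show "semi_unitary_gcd i j > 0" using m0 by (simp add: semi_unitary_gcd_def m_def)
  have "unitary_divisor d m" if "d \<in> ?M" for d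
  proof -
    have d: "d dvd i" "d dvd j" "coprime d (j div d)" using that by (auto simp: unitary_divisor_def)
    let ?l = "lcm d m"
    have l: "?l dvd j" "?l dvd i" using d m by auto
    \<comment> \<open>A common prime would divide \<open>d\<close> or \<open>m\<close>, hence divide it together with its codivisor in \<open>j\<close>.\<close>
    have "coprime ?l (j div ?l)"
    proof (rule ccontr)
      assume "\<not> coprime ?l (j div ?l)"
      then have "gcd ?l (j div ?l) \<noteq> 1" by (simp only: coprime_iff_gcd_eq_1 not_False_eq_True)
      then obtain q where "prime q" "q dvd gcd ?l (j div ?l)" using prime_factor_nat by blast
      then have q: "prime q" "q dvd ?l" "q dvd j div ?l" by auto
      have jl: "j div ?l dvd j div d" "j div ?l dvd j div m"
        by (rule codivisor_dvd_codivisor; use l(1) j in simp)+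
      have "?l dvd d * m" by (intro lcm_least) auto
      then have "q dvd d \<or> q dvd m"
        using q(1,2) by (meson prime_dvd_mult_iff dvd_trans)
      then show False
        using d(3) m(3) q jl by (meson coprime_common_divisor dvd_trans not_prime_unit)
    qed
    then have "?l \<in> ?M" using l by (simp add: unitary_divisor_def)
    then have "?l \<le> m" unfolding m_def by (intro Max_ge fin)
    moreover have "m \<le> ?l" using m0 d(1) i by (intro dvd_imp_le) (auto intro: gr0I)
    ultimately have "?l = m" by (rule le_antisym)
    then have dm: "d dvd m" by (metis dvd_lcm1)
    obtain c k where ck: "m = d * c" "j = m * k" using dm m(2) by (elim dvdE)
    have "m div d dvd j div d" using m0 unfolding ck by simp
    then show ?thesis
      using dm d(3) by (meson coprime_divisors dvd_refl unitary_divisor_def)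
  qed
  moreover have "d \<in> ?M" if "unitary_divisor d m" for d
  proof -
    have d: "d dvd m" "coprime d (m div d)" using that by (auto simp: unitary_divisor_def)
    have d0: "d > 0" using d(1) m0 by (auto intro: gr0I)
    have "j div d = (m div d) * (j div m)"
    proof -
      obtain c k where "m = d * c" "j = m * k" using d(1) m(2) by (elim dvdE)
      then show ?thesis using m0 by simp
    qed
    moreover have "coprime d (j div m)"
      using m(3) d(1) by (meson coprime_divisors dvd_refl)
    ultimately have "coprime d (j div d)" using d(2) by simp
    then show ?thesis using d(1) m by (auto simp: unitary_divisor_def intro: dvd_trans)
  qed
  ultimately show "?M = {d. unitary_divisor d (semi_unitary_gcd i j)}"
    unfolding semi_unitary_gcd_def m_def[symmetric] by blast
qed

section \<open>Power sums over integers free of given primes\<close>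

lemma power_Suc_diff_bounds:
  fixes a b :: real
  assumes "0 \<le> a" "a \<le> b"
  shows "real (p + 1) * a ^ p * (b - a) \<le> b ^ (p + 1) - a ^ (p + 1)"
    and "b ^ (p + 1) - a ^ (p + 1) \<le> real (p + 1) * b ^ p * (b - a)"
proof (induction p)
  case 0
  { case 1 show ?case by simp next case 2 show ?case by simp }
next
  case (Suc p)
  have mono: "a ^ (p + 1) \<le> b ^ (p + 1)" using assms by (intro power_mono) auto
  {
    case 1
    have "real (p + 2) * a ^ (p + 1) * (b - a)
        = a * (real (p + 1) * a ^ p * (b - a)) + a ^ (p + 1) * (b - a)"
      by (simp add: algebra_simps)
    also have "\<dots> \<le> a * (b ^ (p + 1) - a ^ (p + 1)) + b ^ (p + 1) * (b - a)"
      using Suc.IH(1) assms mono by (intro add_mono mult_left_mono mult_right_mono) auto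
    finally show ?case by (simp add: algebra_simps)
  next
    case 2
    have "b ^ (p + 2) - a ^ (p + 2) = b * (b ^ (p + 1) - a ^ (p + 1)) + a ^ (p + 1) * (b - a)"
      by (simp add: algebra_simps)
    also have "\<dots> \<le> b * (real (p + 1) * b ^ p * (b - a)) + b ^ (p + 1) * (b - a)"
      using Suc.IH(2) assms mono by (intro add_mono mult_left_mono mult_right_mono) auto
    finally show ?case by (simp add: algebra_simps)
  }
qed

lemma divide_le_addI:
  fixes c :: real
  assumes "c > 0" "a - b \<le> c * d"
  shows "a / c \<le> b / c + d"
proof -
  have "a / c \<le> (b + c * d) / c" using assms by (intro divide_right_mono) auto
  also have "\<dots> = b / c + d" using assms(1) by (simp add: add_divide_distrib)
  finally show ?thesis .
qed

lemma add_le_divideI: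
  fixes c :: real
  assumes "c > 0" "c * d \<le> a - b"
  shows "b / c + d \<le> a / c"
proof -
  have "b / c + d = (b + c * d) / c" using assms(1) by (simp add: add_divide_distrib)
  also have "\<dots> \<le> a / c" using assms by (intro divide_right_mono) auto
  finally show ?thesis .
qed

text \<open>
  Over each unit interval \<open>t ^ (p + 1) / (p + 1)\<close> increases by an amount between the values of \<open>t ^ p\<close>
  at the two end points.
\<close>

lemma sum_power_bounds:
  shows "real N ^ (p + 1) / real (p + 1) \<le> (\<Sum>d=1..N. real d ^ p)"
    and "p > 0 \<Longrightarrow> (\<Sum>d=1..N. real d ^ p) \<le> real N ^ (p + 1) / real (p + 1) + real N ^ p"
proof (induction N)
  case 0
  { case 1 show ?case by simp next case 2 then show ?case by simp }
next
  case (Suc N)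
  note b = power_Suc_diff_bounds[of "real N" "real (Suc N)" p]
  {
    case 1
    have "real (Suc N) ^ (p + 1) / real (p + 1)
        \<le> real N ^ (p + 1) / real (p + 1) + real (Suc N) ^ p"
      by (rule divide_le_addI) (use b(2) in auto)
    then show ?case using Suc.IH(1) by simp
  next
    case 2
    have "real N ^ (p + 1) / real (p + 1) + real N ^ p \<le> real (Suc N) ^ (p + 1) / real (p + 1)"
      by (rule add_le_divideI) (use b(1) in auto)
    then show ?case using Suc.IH(2)[OF 2] by simp
  }
qed

definition coprime_power_sum :: "nat \<Rightarrow> nat set \<Rightarrow> real \<Rightarrow> real" where
  "coprime_power_sum p P y = (\<Sum>d | 1 \<le> d \<and> real d \<le> y \<and> (\<forall>q\<in>P. \<not> q dvd d). real d ^ p)"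

text \<open>
  For the set of prime divisors of \<open>n\<close> this is \<open>\<phi>(n) / n\<close>, with \<open>\<phi>\<close> Euler's totient function.
\<close>

definition totient_ratio :: "nat set \<Rightarrow> real" where
  "totient_ratio P = (\<Prod>q\<in>P. 1 - 1 / real q)"

lemma finite_nat_le_real: "finite {d::nat. real d \<le> y}"
proof (rule finite_subset)
  show "{d::nat. real d \<le> y} \<subseteq> {..nat \<lfloor>y\<rfloor>}" using le_nat_floor by blast
qed simp

lemma atLeastAtMost_nat_floor: "y \<ge> 0 \<Longrightarrow> {d::nat. 1 \<le> d \<and> real d \<le> y} = {1..nat \<lfloor>y\<rfloor>}"
proof (intro set_eqI iffI)
  fix d assume y: "y \<ge> 0" and "d \<in> {1..nat \<lfloor>y\<rfloor>}"
  then have "1 \<le> d" "real d \<le> real (nat \<lfloor>y\<rfloor>)" by auto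
  moreover have "real (nat \<lfloor>y\<rfloor>) \<le> y" using y by (rule of_nat_floor)
  ultimately show "d \<in> {d. 1 \<le> d \<and> real d \<le> y}" by simp
qed (auto intro: le_nat_floor)

lemma coprime_power_sum_empty:
  assumes p: "p > 0" and y: "y \<ge> 0"
  shows "\<bar>coprime_power_sum p {} y - y ^ (p + 1) / real (p + 1)\<bar> \<le> y ^ p"
proof -
  define N where "N = nat \<lfloor>y\<rfloor>"
  have N: "real N \<le> y" "y - real N \<le> 1" using y by (auto simp: N_def) linarith
  have eq: "coprime_power_sum p {} y = (\<Sum>d=1..N. real d ^ p)"
    using atLeastAtMost_nat_floor[OF y] by (simp add: coprime_power_sum_def N_def)
  have pw: "real N ^ p \<le> y ^ p" "real N ^ (p + 1) \<le> y ^ (p + 1)"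
    using N y by (auto intro!: power_mono simp del: power_Suc)
  have "y ^ (p + 1) - real N ^ (p + 1) \<le> real (p + 1) * y ^ p * (y - real N)"
    by (rule power_Suc_diff_bounds) (use N in auto)
  also have "\<dots> \<le> real (p + 1) * y ^ p * 1"
    using N y by (intro mult_left_mono) auto
  finally have "y ^ (p + 1) / real (p + 1) \<le> real N ^ (p + 1) / real (p + 1) + y ^ p"
    by (intro divide_le_addI) auto
  moreover have "real N ^ (p + 1) / real (p + 1) \<le> y ^ (p + 1) / real (p + 1)"
    using pw by (intro divide_right_mono) auto
  ultimately show ?thesis
    using sum_power_bounds(1)[of N p] sum_power_bounds(2)[OF p, of N] pw unfolding eq by linarith
qed

text \<open>
  One sieve step: the multiples of \<open>q\<close> that avoid \<open>P\<close> are \<open>q\<close> times the integers up to \<open>y / q\<close>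
  that avoid \<open>P\<close>, because \<open>q\<close> itself is not divisible by a prime of \<open>P\<close>.
\<close>

lemma coprime_power_sum_insert:
  assumes q: "prime q" and P: "finite P" "\<And>r. r \<in> P \<Longrightarrow> prime r" "q \<notin> P"
  shows "coprime_power_sum p (insert q P) y
    = coprime_power_sum p P y - real q ^ p * coprime_power_sum p P (y / real q)"
proof -
  have q0: "q > 0" using q by (rule prime_gt_0_nat)
  let ?A = "{d. 1 \<le> d \<and> real d \<le> y \<and> (\<forall>r\<in>P. \<not> r dvd d)}"
  let ?B = "{d. 1 \<le> d \<and> real d \<le> y / real q \<and> (\<forall>r\<in>P. \<not> r dvd d)}"
  have fin: "finite ?A" by (rule finite_subset[OF _ finite_nat_le_real[of y]]) auto
  have split: "(\<Sum>d\<in>?A. real d ^ p) = (\<Sum>d\<in>?A - {d. q dvd d}. real d ^ p) + (\<Sum>d\<in>?A \<inter> {d. q dvd d}. real d ^ p)"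
    using sum.Int_Diff[OF fin, of "\<lambda>d. real d ^ p" "{d. q dvd d}"] by simp
  have diff: "?A - {d. q dvd d} = {d. 1 \<le> d \<and> real d \<le> y \<and> (\<forall>r\<in>insert q P. \<not> r dvd d)}"
    by auto
  have mults: "(\<Sum>d\<in>?A \<inter> {d. q dvd d}. real d ^ p) = (\<Sum>k\<in>?B. real (q * k) ^ p)"
  proof (rule sum.reindex_bij_witness[where i = "\<lambda>k. q * k" and j = "\<lambda>d. d div q"])
    fix d assume d: "d \<in> ?A \<inter> {d. q dvd d}"
    then obtain k where k: "d = q * k" by auto
    then show "q * (d div q) = d" "real (q * (d div q)) ^ p = real d ^ p" by auto
    show "d div q \<in> ?B"
      using d q0 unfolding k by (auto simp: field_simps)
  next
    fix k assume k: "k \<in> ?B"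
    show "q * k div q = k" using q0 by simp
    have "\<not> r dvd q" if "r \<in> P" for r
      using that P q by (metis primes_dvd_imp_eq)
    then show "q * k \<in> ?A \<inter> {d. q dvd d}"
      using k q0 P(2) by (auto simp: field_simps prime_dvd_mult_iff)
  qed
  have scale: "(\<Sum>k\<in>?B. real (q * k) ^ p) = real q ^ p * (\<Sum>k\<in>?B. real k ^ p)"
    by (simp only: of_nat_mult power_mult_distrib sum_distrib_left)
  show ?thesis
    using split unfolding diff mults scale coprime_power_sum_def by linarith
qed

text \<open>
  Each sieve step doubles the error: rescaling \<open>y\<close> to \<open>y / q\<close> costs nothing, since the factor
  \<open>q ^ p\<close> in front cancels the gain in \<open>(y / q) ^ p\<close>.
\<close>

theorem coprime_power_sum_asymptotic:
  assumes p: "p > 0" and y: "y \<ge> 0" and P: "finite P" "\<And>r. r \<in> P \<Longrightarrow> prime r"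
  shows "\<bar>coprime_power_sum p P y - totient_ratio P * y ^ (p + 1) / real (p + 1)\<bar> \<le> 2 ^ card P * y ^ p"
  using P y
proof (induction P arbitrary: y rule: finite_induct)
  case empty
  then show ?case using coprime_power_sum_empty[OF p] by (simp add: totient_ratio_def)
next
  case (insert q P)
  have q: "prime q" and q0: "real q > 0"
    using insert.prems(1) by (auto intro: prime_gt_0_nat)
  let ?t = "totient_ratio P"
  have 1: "\<bar>coprime_power_sum p P y - ?t * y ^ (p + 1) / real (p + 1)\<bar> \<le> 2 ^ card P * y ^ p"
    by (rule insert.IH) (use insert.prems in auto)
  have 2: "\<bar>coprime_power_sum p P (y / q) - ?t * (y / q) ^ (p + 1) / real (p + 1)\<bar>
      \<le> 2 ^ card P * (y / q) ^ p"
    by (rule insert.IH) (use insert.prems q0 in auto)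
  have "\<bar>real q ^ p * coprime_power_sum p P (y / q) - ?t / real q * y ^ (p + 1) / real (p + 1)\<bar>
      = real q ^ p * \<bar>coprime_power_sum p P (y / q) - ?t * (y / q) ^ (p + 1) / real (p + 1)\<bar>"
  proof -
    have "?t / real q * y ^ (p + 1) / real (p + 1)
        = real q ^ p * (?t * (y / q) ^ (p + 1) / real (p + 1))"
      using q0 by (simp add: power_divide)
    then show ?thesis
      by (simp only: abs_mult flip: right_diff_distrib) simp
  qed
  also have "\<dots> \<le> real q ^ p * (2 ^ card P * (y / q) ^ p)"
    using 2 q0 by (intro mult_left_mono) auto
  also have "\<dots> = 2 ^ card P * y ^ p"
    using q0 by (simp add: power_divide)
  finally have 3: "\<bar>real q ^ p * coprime_power_sum p P (y / q)
      - ?t / real q * y ^ (p + 1) / real (p + 1)\<bar> \<le> 2 ^ card P * y ^ p" .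
  have t: "totient_ratio (insert q P) * y ^ (p + 1) / real (p + 1)
      = ?t * y ^ (p + 1) / real (p + 1) - ?t / real q * y ^ (p + 1) / real (p + 1)"
  proof -
    have "totient_ratio (insert q P) = ?t - ?t / real q"
      using insert.hyps by (simp add: totient_ratio_def algebra_simps)
    then show ?thesis by (simp only: left_diff_distrib diff_divide_distrib)
  qed
  have c: "coprime_power_sum p (insert q P) y
      = coprime_power_sum p P y - real q ^ p * coprime_power_sum p P (y / real q)"
    by (rule coprime_power_sum_insert) (use q insert.hyps insert.prems in auto)
  have "2 ^ card (insert q P) * y ^ p = 2 ^ card P * y ^ p + 2 ^ card P * y ^ p"
    using insert.hyps by simp
  then show ?case
    unfolding t c using 1 3 by linarith
qed

section \<open>Rearranging the semi-unitary power sum\<close>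

definition coprime_jordan_sum :: "nat \<Rightarrow> nat \<Rightarrow> real \<Rightarrow> real" where
  "coprime_jordan_sum p b y = (\<Sum>d | 1 \<le> d \<and> real d \<le> y \<and> coprime d b. unitary_jordan p d)"

lemma coprime_iff_no_prime_factor:
  fixes k m :: nat
  assumes "m > 0"
  shows "coprime k m \<longleftrightarrow> (\<forall>q\<in>prime_factors m. \<not> q dvd k)"
proof
  assume "coprime k m"
  then show "\<forall>q\<in>prime_factors m. \<not> q dvd k"
    by (meson coprime_common_divisor in_prime_factors_iff not_prime_unit)
next
  assume no: "\<forall>q\<in>prime_factors m. \<not> q dvd k"
  show "coprime k m"
  proof (rule ccontr)
    assume "\<not> coprime k m"
    then have "gcd k m \<noteq> 1" by (simp only: coprime_iff_gcd_eq_1 not_False_eq_True)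
    then obtain q where "prime q" "q dvd gcd k m" using prime_factor_nat by blast
    then have "prime q" "q dvd k" "q dvd m" by auto
    with no assms show False by (auto simp: prime_factors_dvd)
  qed
qed

text \<open>
  In \<open>d = e * k\<close> the conditions that \<open>e\<close> be a unitary divisor of \<open>d\<close> and that \<open>d\<close> be coprime to \<open>b\<close>
  amount to \<open>coprime e b\<close> and to \<open>k\<close> avoiding the primes of \<open>e * b\<close>, so the inner sum over \<open>k\<close> is of
  the sieved type.
\<close>

lemma coprime_jordan_sum_expand:
  assumes b: "b > 0"
  shows "coprime_jordan_sum p b y
    = (\<Sum>e | 1 \<le> e \<and> real e \<le> y \<and> coprime e b.
         (-1) ^ omega e * coprime_power_sum p (prime_factors (e * b)) (y / real e))"
proof -
  let ?X = "{d. 1 \<le> d \<and> real d \<le> y \<and> coprime d b}"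
  let ?Y = "\<lambda>e. {k. 1 \<le> k \<and> real k \<le> y / real e \<and> (\<forall>q\<in>prime_factors (e * b). \<not> q dvd k)}"
  have finX: "finite ?X" by (rule finite_subset[OF _ finite_nat_le_real[of y]]) auto
  have finY: "finite (?Y e)" for e
    by (rule finite_subset[OF _ finite_nat_le_real[of "y / real e"]]) auto
  have "coprime_jordan_sum p b y
      = (\<Sum>d\<in>?X. \<Sum>e | unitary_divisor e d. (-1) ^ omega e * real (d div e) ^ p)"
    unfolding coprime_jordan_sum_def by (intro sum.cong) (simp_all add: unitary_jordan_eq_sum)
  also have "\<dots> = (\<Sum>(d, e)\<in>Sigma ?X (\<lambda>d. {e. unitary_divisor e d}).
      (-1) ^ omega e * real (d div e) ^ p)"
    by (rule sum.Sigma) (use finX finite_unitary_divisors in auto)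
  also have "\<dots> = (\<Sum>(e, k)\<in>Sigma ?X ?Y. (-1) ^ omega e * real k ^ p)"
  proof (rule sum.reindex_bij_witness[where i = "\<lambda>(e, k). (e * k, e)" and j = "\<lambda>(d, e). (e, d div e)"])
    fix z assume z: "z \<in> Sigma ?X (\<lambda>d. {e. unitary_divisor e d})"
    then obtain d e where z_eq: "z = (d, e)" and d: "1 \<le> d" "real d \<le> y" "coprime d b"
      and e: "unitary_divisor e d" by auto
    obtain k where k: "d = e * k" using e by (auto simp: unitary_divisor_def)
    have pos: "e > 0" "k > 0" using d(1) k by (auto intro: gr0I)
    have dk: "d div e = k" using pos k by simp
    have cop: "coprime k e" using e pos k by (simp add: unitary_divisor_def coprime_commute)
    have "real e * 1 \<le> real e * real k" using pos by (intro mult_left_mono) auto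
    then have "real e \<le> y" using d(2) k by simp
    moreover have "real k \<le> y / real e" using d(2) k pos by (simp add: field_simps)
    moreover have "coprime k (e * b)" using cop d(3) k by simp
    ultimately show "(case z of (d, e) \<Rightarrow> (e, d div e)) \<in> Sigma ?X ?Y"
      using pos d(3) k b coprime_iff_no_prime_factor[of "e * b" k] by (simp add: z_eq dk)
    show "(case (case z of (d, e) \<Rightarrow> (e, d div e)) of (e, k) \<Rightarrow> (e * k, e)) = z"
      by (simp add: z_eq dk k)
    show "(case (case z of (d, e) \<Rightarrow> (e, d div e)) of (e, k) \<Rightarrow> (-1) ^ omega e * real k ^ p)
        = (case z of (d, e) \<Rightarrow> (-1) ^ omega e * real (d div e) ^ p)"
      by (simp add: z_eq)
  next
    fix z assume z: "z \<in> Sigma ?X ?Y"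
    then obtain e k where z_eq: "z = (e, k)" and e: "1 \<le> e" "coprime e b"
      and k: "1 \<le> k" "real k \<le> y / real e" "\<forall>q\<in>prime_factors (e * b). \<not> q dvd k" by auto
    have cop: "coprime k (e * b)"
      using k(3) e b coprime_iff_no_prime_factor[of "e * b" k] by simp
    have "real (e * k) \<le> y" using k e by (simp add: field_simps)
    then show "(case z of (e, k) \<Rightarrow> (e * k, e)) \<in> Sigma ?X (\<lambda>d. {e. unitary_divisor e d})"
      using e k(1) cop by (simp add: z_eq unitary_divisor_def coprime_commute)
    show "(case (case z of (e, k) \<Rightarrow> (e * k, e)) of (d, e) \<Rightarrow> (e, d div e)) = z"
      using e by (simp add: z_eq)
  qed
  also have "\<dots> = (\<Sum>e\<in>?X. \<Sum>k\<in>?Y e. (-1) ^ omega e * real k ^ p)"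
    by (rule sum.Sigma[symmetric]) (use finX finY in auto)
  also have "\<dots> = (\<Sum>e\<in>?X. (-1) ^ omega e * coprime_power_sum p (prime_factors (e * b)) (y / real e))"
    unfolding coprime_power_sum_def by (simp only: sum_distrib_left)
  finally show ?thesis .
qed

text \<open>
  Put \<open>i = d * a\<close> and \<open>j = d * b\<close> for each \<open>d\<close> that divides \<open>i\<close> and is a unitary divisor of \<open>j\<close>: the
  second condition becomes \<open>coprime d b\<close>, and \<open>i, j \<le> x\<close> becomes \<open>d \<le> x / max a b\<close>.
\<close>

theorem semi_unitary_power_sum_eq:
  assumes x: "x \<ge> 0"
  shows "semi_unitary_power_sum p x
    = (\<Sum>a=1..nat \<lfloor>x\<rfloor>. \<Sum>b=1..nat \<lfloor>x\<rfloor>. coprime_jordan_sum p b (x / real (max a b)))"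
proof -
  let ?I = "{1..nat \<lfloor>x\<rfloor>}"
  let ?D = "\<lambda>(i, j). {d. d dvd i \<and> unitary_divisor d j}"
  let ?E = "\<lambda>(a, b). {d. 1 \<le> d \<and> real d \<le> x / real (max a b) \<and> coprime d b}"
  have I: "n \<in> ?I \<longleftrightarrow> 1 \<le> n \<and> real n \<le> x" for n
    using atLeastAtMost_nat_floor[OF x] by blast
  have finE: "finite (?E z)" for z
    by (cases z, rule finite_subset[OF _ finite_nat_le_real[of "x / real (max (fst z) (snd z))"]]) auto
  have finD: "finite (?D z)" if "z \<in> ?I \<times> ?I" for z
    using that by (cases z, rule_tac finite_subset[of _ "{d. d dvd fst z}"]) auto
  have "{(i, j). 1 \<le> i \<and> 1 \<le> j \<and> real i \<le> x \<and> real j \<le> x} = ?I \<times> ?I"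
    using I by (auto simp del: atLeastAtMost_iff)
  then have "semi_unitary_power_sum p x = (\<Sum>(i, j)\<in>?I \<times> ?I. real (semi_unitary_gcd i j) ^ p)"
    by (simp only: semi_unitary_power_sum_def)
  also have "\<dots> = (\<Sum>z\<in>?I \<times> ?I. \<Sum>d\<in>?D z. unitary_jordan p d)"
  proof (intro sum.cong refl)
    fix z assume "z \<in> ?I \<times> ?I"
    then obtain i j where z: "z = (i, j)" and ij: "i > 0" "j > 0" by (cases z) auto
    show "(case z of (i, j) \<Rightarrow> real (semi_unitary_gcd i j) ^ p) = (\<Sum>d\<in>?D z. unitary_jordan p d)"
      using common_unitary_divisors[OF ij] power_eq_sum_unitary_jordan by (simp add: z)
  qed
  also have "\<dots> = (\<Sum>(z, d)\<in>Sigma (?I \<times> ?I) ?D. unitary_jordan p d)"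
    by (rule sum.Sigma) (use finD in auto)
  also have "\<dots> = (\<Sum>(z, d)\<in>Sigma (?I \<times> ?I) ?E. unitary_jordan p d)"
  proof (rule sum.reindex_bij_witness[where j = "\<lambda>((i, j), d). ((i div d, j div d), d)"
        and i = "\<lambda>((a, b), d). ((a * d, b * d), d)"])
    fix w assume "w \<in> Sigma (?I \<times> ?I) ?D"
    then obtain i j d where w: "w = ((i, j), d)" and i: "1 \<le> i" "real i \<le> x"
      and j: "1 \<le> j" "real j \<le> x" and d: "d dvd i" "unitary_divisor d j"
      using I by auto
    have "d dvd j" using d(2) by (simp add: unitary_divisor_def)
    then obtain a b where ab: "i = d * a" "j = d * b" using d(1) by (elim dvdE)
    have pos: "d > 0" "a > 0" "b > 0" using i(1) j(1) ab by (auto intro: gr0I)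
    have dv: "i div d = a" "j div d = b" using pos ab by simp_all
    have "real a \<le> real d * real a" "real b \<le> real d * real b" using pos by auto
    moreover have "real i = real d * real a" "real j = real d * real b" by (simp_all add: ab)
    ultimately have "real a \<le> x" "real b \<le> x" using i j by linarith+
    then have "a \<in> ?I" "b \<in> ?I" using pos by (simp_all only: I) simp_all
    moreover have "real d \<le> x / real (max a b)"
      using i j ab pos by (cases "a \<le> b") (simp_all add: field_simps max_def)
    moreover have "coprime d b" using d dv by (simp add: unitary_divisor_def)
    ultimately show "(case w of (z, d) \<Rightarrow> (case z of (i, j) \<Rightarrow> \<lambda>d. ((i div d, j div d), d)) d)
        \<in> Sigma (?I \<times> ?I) ?E"
      using pos by (simp add: w dv)
    show "(case case w of (z, d) \<Rightarrow> (case z of (i, j) \<Rightarrow> \<lambda>d. ((i div d, j div d), d)) d of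
        (z, d) \<Rightarrow> (case z of (a, b) \<Rightarrow> \<lambda>d. ((a * d, b * d), d)) d) = w"
      using pos by (simp add: w ab mult.commute)
    show "(case case w of (z, d) \<Rightarrow> (case z of (i, j) \<Rightarrow> \<lambda>d. ((i div d, j div d), d)) d of
        (z, d) \<Rightarrow> unitary_jordan p d) = (case w of (z, d) \<Rightarrow> unitary_jordan p d)"
      by (simp add: w)
  next
    fix w assume "w \<in> Sigma (?I \<times> ?I) ?E"
    then obtain a b d where w: "w = ((a, b), d)" and ab: "1 \<le> a" "1 \<le> b"
      and d: "1 \<le> d" "real d \<le> x / real (max a b)" "coprime d b"
      by auto
    have mx: "real d * real (max a b) \<le> x" using d(2) ab by (simp add: field_simps)
    have "real d * real a \<le> real d * real (max a b)" "real d * real b \<le> real d * real (max a b)"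
      by (intro mult_left_mono; simp)+
    then have "real d * real a \<le> x" "real d * real b \<le> x" using mx by linarith+
    then have "real (a * d) \<le> x" "real (b * d) \<le> x" by (simp_all add: mult.commute)
    then have "a * d \<in> ?I" "b * d \<in> ?I" using ab d(1) by (simp_all only: I) simp_all
    moreover have "unitary_divisor d (b * d)" using d by (simp add: unitary_divisor_def)
    ultimately show "(case w of (z, d) \<Rightarrow> (case z of (a, b) \<Rightarrow> \<lambda>d. ((a * d, b * d), d)) d)
        \<in> Sigma (?I \<times> ?I) ?D"
      by (simp add: w)
    show "(case case w of (z, d) \<Rightarrow> (case z of (a, b) \<Rightarrow> \<lambda>d. ((a * d, b * d), d)) d of
        (z, d) \<Rightarrow> (case z of (i, j) \<Rightarrow> \<lambda>d. ((i div d, j div d), d)) d) = w"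
      using d(1) by (simp add: w)
  qed
  also have "\<dots> = (\<Sum>z\<in>?I \<times> ?I. \<Sum>d\<in>?E z. unitary_jordan p d)"
    by (rule sum.Sigma[symmetric]) (use finE in auto)
  also have "\<dots> = (\<Sum>(a, b)\<in>?I \<times> ?I. coprime_jordan_sum p b (x / real (max a b)))"
    unfolding coprime_jordan_sum_def by (intro sum.cong) auto
  also have "\<dots> = (\<Sum>a=1..nat \<lfloor>x\<rfloor>. \<Sum>b=1..nat \<lfloor>x\<rfloor>. coprime_jordan_sum p b (x / real (max a b)))"
    by (rule sum.cartesian_product[symmetric])
  finally show ?thesis .
qed

section \<open>The leading constant as an Euler product\<close>

text \<open>
  The Euler factor of \<open>D_star p\<close> at \<open>q\<close>.
\<close>

definition local_factor :: "nat \<Rightarrow> nat \<Rightarrow> real" where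
  "local_factor p q = 1 - 2 / real q ^ (p + 1) + 1 / real q ^ (p + 2)"

lemma prime_power_inverse_bounds:
  assumes q: "prime q" and p: "p \<ge> 1"
  shows "0 < 1 / real q ^ (p + 1)" "1 / real q ^ (p + 1) \<le> 1 / 4"
    "1 / real q ^ (p + 1) \<le> 1 / real q" "1 / real q \<le> 1 / 2"
proof -
  have q2: "2 \<le> real q" using prime_ge_2_nat[OF q] by simp
  have "(4::real) = 2 ^ 2" by simp
  also have "\<dots> \<le> real q ^ 2" using q2 by (intro power_mono) auto
  also have "\<dots> \<le> real q ^ (p + 1)" using q2 p by (intro power_increasing) auto
  finally show "1 / real q ^ (p + 1) \<le> 1 / 4" by (intro divide_left_mono) auto
  have "real q ^ 1 \<le> real q ^ (p + 1)" using q2 by (intro power_increasing) auto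
  then show "1 / real q ^ (p + 1) \<le> 1 / real q" using q2 by (intro divide_left_mono) auto
  show "0 < 1 / real q ^ (p + 1)" "1 / real q \<le> 1 / 2" using q2 by auto
qed

lemma local_factor_pos: "prime q \<Longrightarrow> p \<ge> 1 \<Longrightarrow> local_factor p q > 0"
  using prime_power_inverse_bounds(2)[of q p] prime_gt_0_nat[of q]
  by (auto simp: local_factor_def intro!: add_pos_nonneg)

lemma g_eq: "g p n = (\<Prod>q\<in>prime_factors n. (1 - 1 / real q) * ((1 - 1 / real q ^ (p + 1)) / local_factor p q))"
  unfolding g_def local_factor_def by (simp only: divide_inverse mult.assoc)

text \<open>
  With \<open>r = 1 / q\<close> and \<open>u = 1 / q ^ (p + 1)\<close>, each factor of \<open>g p n\<close> is \<open>1 - r - u + r * u\<close> divided by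
  \<open>1 - 2 * u + r * u\<close>, and \<open>u \<le> r\<close>.
\<close>

lemma g_bounds:
  assumes p: "p \<ge> 1"
  shows "0 \<le> g p n" "g p n \<le> 1"
proof -
  have b: "0 \<le> (1 - 1 / real q) * ((1 - 1 / real q ^ (p + 1)) / local_factor p q)
      \<and> (1 - 1 / real q) * ((1 - 1 / real q ^ (p + 1)) / local_factor p q) \<le> 1"
    if "q \<in> prime_factors n" for q
  proof -
    have q: "prime q" using that by auto
    note u = prime_power_inverse_bounds[OF q p]
    have L: "local_factor p q > 0" by (rule local_factor_pos[OF q p])
    have "(1 - 1 / real q) * (1 - 1 / real q ^ (p + 1))
        = 1 - 1 / real q ^ (p + 1) - 1 / real q + 1 / real q ^ (p + 2)"
    proof -
      have "(1 - r) * (1 - u) = 1 - u - r + r * u" for r u :: real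
        by (simp add: algebra_simps)
      from this[of "1 / real q" "1 / real q ^ (p + 1)"] show ?thesis by simp
    qed
    then have "(1 - 1 / real q) * (1 - 1 / real q ^ (p + 1)) \<le> local_factor p q"
      using u(3) unfolding local_factor_def by linarith
    then show ?thesis using L u by (auto intro!: mult_nonneg_nonneg divide_nonneg_pos)
  qed
  show "0 \<le> g p n" unfolding g_eq using b by (intro prod_nonneg) blast
  show "g p n \<le> 1" unfolding g_eq using b by (intro prod_le_1) blast
qed

text \<open>
  The coefficients that arise when \<open>coprime_power_sum_asymptotic\<close> is inserted into
  \<open>coprime_jordan_sum_expand\<close>: the contribution of \<open>e\<close> to the main term, apart from the factors
  depending only on \<open>b\<close> and \<open>y\<close>. The value at \<open>e = 0\<close> is \<open>0\<close> because division by zero gives zero.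
\<close>

definition sieve_coeff :: "nat \<Rightarrow> nat \<Rightarrow> nat \<Rightarrow> real" where
  "sieve_coeff p b e = (if coprime e b
     then (-1) ^ omega e * totient_ratio (prime_factors e) / real e ^ (p + 1) else 0)"

lemma prime_factors_coprime_disjoint:
  fixes m n :: nat
  shows "coprime m n \<Longrightarrow> prime_factors m \<inter> prime_factors n = {}"
  by (auto dest: coprime_common_divisor not_prime_unit)

lemma totient_ratio_mult:
  fixes m n :: nat
  assumes "coprime m n" "m > 0" "n > 0"
  shows "totient_ratio (prime_factors (m * n))
    = totient_ratio (prime_factors m) * totient_ratio (prime_factors n)"
  using assms prime_factors_coprime_disjoint[OF assms(1)] unfolding totient_ratio_def
  by (subst prime_factors_product) (auto intro: prod.union_disjoint)

lemma omega_mult: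
  assumes "coprime m n" "m > 0" "n > 0"
  shows "omega (m * n) = omega m + omega n"
  using assms prime_factors_coprime_disjoint[OF assms(1)] unfolding omega_def
  by (subst prime_factors_product) (auto intro: card_Un_disjoint)

lemma totient_ratio_bounds:
  fixes n :: nat
  shows "0 \<le> totient_ratio (prime_factors n)" "totient_ratio (prime_factors n) \<le> 1"
proof -
  have b: "0 \<le> 1 - 1 / real q \<and> 1 - 1 / real q \<le> 1" if "q \<in> prime_factors n" for q
  proof -
    have "prime q" using that by auto
    from prime_gt_0_nat[OF this] show ?thesis by simp
  qed
  show "0 \<le> totient_ratio (prime_factors n)"
    unfolding totient_ratio_def using b by (intro prod_nonneg) blast
  show "totient_ratio (prime_factors n) \<le> 1"
    unfolding totient_ratio_def using b by (intro prod_le_1) blast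
qed

lemma sieve_coeff_0 [simp]: "sieve_coeff p b 0 = 0"
  by (simp add: sieve_coeff_def)

lemma sieve_coeff_1: "sieve_coeff p b 1 = 1"
  by (simp add: sieve_coeff_def omega_def totient_ratio_def)

lemma sieve_coeff_mult:
  assumes "coprime m n"
  shows "sieve_coeff p b (m * n) = sieve_coeff p b m * sieve_coeff p b n"
proof (cases "m = 0 \<or> n = 0")
  case True
  then show ?thesis by auto
next
  case False
  then have "totient_ratio (prime_factors (m * n))
      = totient_ratio (prime_factors m) * totient_ratio (prime_factors n)"
    "omega (m * n) = omega m + omega n"
    using assms by (auto intro: totient_ratio_mult omega_mult)
  then show ?thesis
    by (simp add: sieve_coeff_def power_add power_mult_distrib mult_ac)
qed

lemma abs_sieve_coeff_le: "\<bar>sieve_coeff p b e\<bar> \<le> 1 / real e ^ (p + 1)"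
proof -
  have "\<bar>(-1) ^ omega e * totient_ratio (prime_factors e) / real e ^ (p + 1)\<bar>
      = totient_ratio (prime_factors e) / real e ^ (p + 1)"
    using totient_ratio_bounds[of e] by (simp add: abs_mult)
  also have "\<dots> \<le> 1 / real e ^ (p + 1)"
    using totient_ratio_bounds[of e] by (intro divide_right_mono) auto
  finally show ?thesis by (simp add: sieve_coeff_def)
qed

lemma summable_inverse_power:
  assumes "s \<ge> 2"
  shows "summable (\<lambda>n. 1 / real n ^ s)"
  using inverse_power_summable[OF assms, where 'a = real] by (simp add: inverse_eq_divide)

lemma has_sum_suminf_inverse_power_bound:
  fixes f :: "nat \<Rightarrow> real"
  assumes s: "s \<ge> 2" and f: "\<And>n. \<bar>f n\<bar> \<le> 1 / real n ^ s"
  shows "summable f" "(f has_sum suminf f) UNIV"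
proof -
  have abs: "summable (\<lambda>n. norm (f n))"
    by (rule summable_comparison_test[OF _ summable_inverse_power[OF s]]) (use f in auto)
  then show "summable f" by (rule summable_norm_cancel)
  then show "(f has_sum suminf f) UNIV"
    using abs by (intro norm_summable_imp_has_sum) auto
qed

text \<open>
  A form of the Euler product in which the values at prime powers are summed as ordinary series. The
  bound \<open>1 / n ^ s\<close> supplies absolute convergence.
\<close>

lemma euler_product_inverse_power_bound:
  fixes f :: "nat \<Rightarrow> real"
  assumes s: "s \<ge> 2" and f: "\<And>n. \<bar>f n\<bar> \<le> 1 / real n ^ s"
    and f0: "f 0 = 0" and f1: "f 1 = 1" and mult: "\<And>m n. coprime m n \<Longrightarrow> f (m * n) = f m * f n"
    and sums: "\<And>q. prime q \<Longrightarrow> (\<lambda>a. f (q ^ a)) sums c q"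
  shows "(\<lambda>N. \<Prod>q | prime q \<and> q \<le> N. c q) \<longlonglongrightarrow> suminf f"
proof -
  note hs = has_sum_suminf_inverse_power_bound[OF s f]
  have "(\<lambda>N. \<Prod>q | prime q \<and> q \<le> N. \<Sum>\<^sub>\<infinity>a. f (q ^ a)) \<longlonglongrightarrow> infsum f UNIV"
    by (rule euler_product_tendsto) (use f0 f1 mult hs(2) in \<open>auto simp: summable_on_def\<close>)
  moreover have "(\<Sum>\<^sub>\<infinity>a. f (q ^ a)) = c q" if q: "prime q" for q
  proof (rule infsumI)
    have "inj (\<lambda>a. q ^ a)"
      using prime_gt_1_nat[OF q] by (auto intro!: injI simp: power_inject_exp)
    moreover have "f summable_on range (\<lambda>a. q ^ a)"
      using hs(2) summable_on_subset_banach[of f UNIV] by (auto simp: summable_on_def)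
    ultimately have "(\<lambda>a. f (q ^ a)) summable_on UNIV"
      using summable_on_reindex[of "\<lambda>a. q ^ a" UNIV f] by (simp add: o_def)
    then have "((\<lambda>a. f (q ^ a)) has_sum infsum (\<lambda>a. f (q ^ a)) UNIV) UNIV" by simp
    moreover from this have "infsum (\<lambda>a. f (q ^ a)) UNIV = c q"
      using has_sum_imp_sums sums[OF q] sums_unique2 by blast
    ultimately show "((\<lambda>a. f (q ^ a)) has_sum c q) UNIV" by simp
  qed
  ultimately show ?thesis
    using infsumI[OF hs(2)] by simp
qed

lemma zeta_eq_suminf:
  assumes "p \<ge> 1"
  shows "zeta (real p + 1) = (\<Sum>n. 1 / real n ^ (p + 1))"
proof -
  have "(\<Sum>n. 1 / real n ^ (p + 1)) = (\<Sum>n. 1 / real (Suc n) ^ (p + 1))"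
    using suminf_split_head[OF summable_inverse_power[of "p + 1"]] assms by simp
  also have "\<dots> = zeta (real p + 1)"
  proof -
    have "real (Suc n) ^ (p + 1) = real (Suc n) powr (real p + 1)" for n
      using powr_realpow[of "real (Suc n)" "p + 1"] by (simp add: add.commute)
    then show ?thesis by (simp add: zeta_def)
  qed
  finally show ?thesis ..
qed

lemma zeta_euler_product:
  assumes p: "p \<ge> 1"
  shows "(\<lambda>N. \<Prod>q | prime q \<and> q \<le> N. 1 / (1 - 1 / real q ^ (p + 1))) \<longlonglongrightarrow> zeta (real p + 1)"
  unfolding zeta_eq_suminf[OF p]
proof (rule euler_product_inverse_power_bound[where s = "p + 1"])
  fix q :: nat assume q: "prime q"
  have "(\<lambda>a. (1 / real q ^ (p + 1)) ^ a) sums (1 / (1 - 1 / real q ^ (p + 1)))"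
    using prime_power_inverse_bounds[OF q p] by (intro geometric_sums) auto
  then show "(\<lambda>a. 1 / real (q ^ a) ^ (p + 1)) sums (1 / (1 - 1 / real q ^ (p + 1)))"
    by (simp add: power_one_over power_mult[symmetric] mult.commute del: power_Suc)
qed (use p in \<open>auto simp: power_mult_distrib\<close>)

text \<open>
  \<open>prodinf\<close> takes a meaningful value only for convergent products; convergence holds here because the
  factor at \<open>q\<close> differs from \<open>1\<close> by at most \<open>2 / q ^ (p + 1)\<close>.
\<close>

lemma D_star_tendsto:
  assumes p: "p \<ge> 1"
  shows "(\<lambda>N. \<Prod>q | prime q \<and> q \<le> N. local_factor p q) \<longlonglongrightarrow> D_star p"
proof -
  define f where "f = (\<lambda>q. if prime q then local_factor p q else 1)"
  have "summable (\<lambda>q. norm (f q - 1))"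
  proof (rule summable_comparison_test)
    show "summable (\<lambda>q. 2 * (1 / real q ^ (p + 1)))"
      using p by (intro summable_mult summable_inverse_power) simp
    have "norm (f q - 1) \<le> 2 * (1 / real q ^ (p + 1))" for q
    proof (cases "prime q")
      case True
      have "1 / real q ^ (p + 2) = 1 / real q ^ (p + 1) * (1 / real q)" by simp
      also have "\<dots> \<le> 1 / real q ^ (p + 1) * 1"
        using prime_power_inverse_bounds[OF True p] by (intro mult_left_mono) auto
      finally have "1 / real q ^ (p + 2) \<le> 1 / real q ^ (p + 1)" by simp
      moreover have "f q - 1 = - 2 * (1 / real q ^ (p + 1)) + 1 / real q ^ (p + 2)"
        using True by (simp add: f_def local_factor_def)
      moreover have "0 \<le> 1 / real q ^ (p + 2)" by simp
      ultimately show ?thesis unfolding real_norm_def by linarith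
    qed (simp add: f_def)
    then show "\<exists>N. \<forall>n\<ge>N. norm (norm (f n - 1)) \<le> 2 * (1 / real n ^ (p + 1))" by simp
  qed
  then have "convergent_prod f"
    by (intro abs_convergent_prod_imp_convergent_prod summable_imp_abs_convergent_prod)
  then have "(\<lambda>N. \<Prod>q\<le>N. f q) \<longlonglongrightarrow> prodinf f" by (rule convergent_prod_LIMSEQ)
  moreover have "(\<Prod>q\<le>N. f q) = (\<Prod>q | prime q \<and> q \<le> N. local_factor p q)" for N
    by (rule prod.mono_neutral_cong_right) (auto simp: f_def)
  moreover have "prodinf f = D_star p" by (simp only: D_star_def f_def local_factor_def)
  ultimately show ?thesis by simp
qed

text \<open>
  For \<open>q\<close> not dividing \<open>b\<close> and \<open>u = 1 / q ^ (p + 1)\<close>, the series is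
  \<open>1 - (1 - 1 / q) * (u + u\<^sup>2 + \<dots>)\<close>, whose value has the numerator \<open>1 - 2 * u + u / q\<close>.
\<close>

lemma sieve_coeff_prime_power_sums:
  assumes q: "prime q" and p: "p \<ge> 1"
  shows "(\<lambda>a. sieve_coeff p b (q ^ a)) sums
    (if q dvd b then 1 else local_factor p q / (1 - 1 / real q ^ (p + 1)))"
proof (cases "q dvd b")
  case True
  have "sieve_coeff p b (q ^ a) = (if a = 0 then 1 else 0)" for a
  proof (cases "a = 0")
    case True
    then show ?thesis using sieve_coeff_1 by simp
  next
    case False
    then have "\<not> coprime (q ^ a) b"
      using \<open>q dvd b\<close> q by (metis coprime_common_divisor dvd_power dvd_refl gr0I not_prime_unit)
    then show ?thesis using False by (simp add: sieve_coeff_def)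
  qed
  then show ?thesis using True sums_single[of 0 "\<lambda>_. 1 :: real"] by simp
next
  case False
  define u where "u = 1 / real q ^ (p + 1)"
  have u: "0 < u" "u < 1" using prime_power_inverse_bounds[OF q p] by (auto simp: u_def)
  \<comment> \<open>The geometric progression has the wrong value at \<open>a = 0\<close>; the second summand corrects it.\<close>
  have eq: "sieve_coeff p b (q ^ a) = - (1 - 1 / real q) * u ^ a + (if a = 0 then 2 - 1 / real q else 0)" for a
  proof (cases "a = 0")
    case True
    then show ?thesis using sieve_coeff_1 by simp
  next
    case a: False
    have "coprime (q ^ a) b" using q False by (simp add: prime_imp_coprime)
    moreover have "prime_factors (q ^ a) = {q}"
      using a q by (simp add: prime_factorization_prime_power)
    moreover have "1 / real (q ^ a) ^ (p + 1) = u ^ a"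
      by (simp add: u_def power_one_over power_mult[symmetric] mult.commute del: power_Suc)
    ultimately show ?thesis
      using a by (simp add: sieve_coeff_def omega_def totient_ratio_def divide_inverse del: power_Suc)
  qed
  have "(\<lambda>a. - (1 - 1 / real q) * u ^ a + (if a = 0 then 2 - 1 / real q else 0)) sums
      (- (1 - 1 / real q) * (1 / (1 - u)) + (2 - 1 / real q))"
    using u by (intro sums_add sums_mult geometric_sums sums_single) auto
  moreover have "- (1 - 1 / real q) * (1 / (1 - u)) + (2 - 1 / real q) = local_factor p q / (1 - u)"
  proof -
    have "local_factor p q = 1 - 2 * u + u * (1 / real q)"
      by (simp add: local_factor_def u_def)
    moreover have "- (1 - r) * (1 / (1 - u)) + (2 - r) = (1 - 2 * u + u * r) / (1 - u)" for r
      using u by (simp add: field_simps)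
    ultimately show ?thesis by metis
  qed
  ultimately show ?thesis using False by (simp add: eq u_def)
qed

text \<open>
  For the primes not dividing \<open>b\<close> the Euler factors are those of \<open>zeta (p + 1) * D_star p\<close>. The
  finitely many primes dividing \<open>b\<close> have Euler factor \<open>1\<close> instead; correcting for them and multiplying
  by \<open>totient_ratio\<close> produces exactly the product \<open>g p b\<close>.
\<close>

theorem sieve_coeff_suminf:
  assumes p: "p \<ge> 1" and b: "b > 0"
  shows "totient_ratio (prime_factors b) * suminf (sieve_coeff p b)
    = zeta (real p + 1) * D_star p * g p b"
proof -
  let ?u = "\<lambda>q. 1 / real q ^ (p + 1)"
  let ?c = "\<lambda>q. if q dvd b then 1 else local_factor p q / (1 - ?u q)"
  let ?r = "\<lambda>q. if q dvd b then (1 - ?u q) / local_factor p q else 1"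
  let ?P = "\<lambda>N. {q. prime q \<and> q \<le> N}"
  have lim1: "(\<lambda>N. prod ?c (?P N)) \<longlonglongrightarrow> suminf (sieve_coeff p b)"
    by (rule euler_product_inverse_power_bound[where s = "p + 1"])
      (use p abs_sieve_coeff_le sieve_coeff_1 sieve_coeff_mult sieve_coeff_prime_power_sums in auto)
  have lim2: "(\<lambda>N. (\<Prod>q\<in>?P N. local_factor p q) * (\<Prod>q\<in>?P N. 1 / (1 - ?u q))
        * (\<Prod>q\<in>prime_factors b. (1 - ?u q) / local_factor p q))
      \<longlonglongrightarrow> D_star p * zeta (real p + 1) * (\<Prod>q\<in>prime_factors b. (1 - ?u q) / local_factor p q)"
    by (intro tendsto_intros D_star_tendsto zeta_euler_product p)
  have eq: "prod ?c (?P N) = (\<Prod>q\<in>?P N. local_factor p q) * (\<Prod>q\<in>?P N. 1 / (1 - ?u q))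
        * (\<Prod>q\<in>prime_factors b. (1 - ?u q) / local_factor p q)" if N: "N \<ge> b" for N
  proof -
    have fin: "finite (?P N)" by (rule finite_subset[of _ "{..N}"]) auto
    have "prod ?c (?P N) = (\<Prod>q\<in>?P N. local_factor p q * (1 / (1 - ?u q)) * ?r q)"
    proof (intro prod.cong refl)
      fix q assume "q \<in> ?P N"
      then have q: "prime q" by simp
      have "1 - ?u q \<noteq> 0" "local_factor p q \<noteq> 0"
        using prime_power_inverse_bounds[OF q p] local_factor_pos[OF q p] by linarith+
      moreover have "(if d then 1 else L / v) = L * (1 / v) * (if d then v / L else 1)"
        if "v \<noteq> 0" "L \<noteq> 0" for d and v L :: real
        using that by simp
      ultimately show "?c q = local_factor p q * (1 / (1 - ?u q)) * ?r q" by metis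
    qed
    also have "\<dots> = (\<Prod>q\<in>?P N. local_factor p q) * (\<Prod>q\<in>?P N. 1 / (1 - ?u q)) * prod ?r (?P N)"
      by (simp only: prod.distrib)
    also have "prod ?r (?P N) = (\<Prod>q\<in>prime_factors b. (1 - ?u q) / local_factor p q)"
      by (rule prod.mono_neutral_cong_right[OF fin])
        (use b N in \<open>auto simp: prime_factors_dvd dest: dvd_imp_le\<close>)
    finally show ?thesis .
  qed
  have "(\<lambda>N. prod ?c (?P N))
      \<longlonglongrightarrow> D_star p * zeta (real p + 1) * (\<Prod>q\<in>prime_factors b. (1 - ?u q) / local_factor p q)"
    by (rule Lim_transform_eventually[OF lim2])
      (use eq in \<open>auto intro: eventually_sequentiallyI[of b]\<close>)
  then have "suminf (sieve_coeff p b)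
      = D_star p * zeta (real p + 1) * (\<Prod>q\<in>prime_factors b. (1 - ?u q) / local_factor p q)"
    using lim1 LIMSEQ_unique by blast
  moreover have "g p b = totient_ratio (prime_factors b)
      * (\<Prod>q\<in>prime_factors b. (1 - ?u q) / local_factor p q)"
    unfolding g_eq totient_ratio_def by (simp only: prod.distrib)
  ultimately show ?thesis by (simp only: mult_ac)
qed

section \<open>Elementary estimates for sums of inverse powers\<close>

text \<open>
  For \<open>s = 2\<close> this telescopes, since \<open>1 / (n + 1)\<^sup>2 \<le> 1 / n - 1 / (n + 1)\<close>; the general case
  follows by pulling out \<open>1 / N ^ (s - 2)\<close>.
\<close>

lemma sum_inverse_power_tail:
  assumes s: "s \<ge> 2" and N: "N \<ge> 1" "N \<le> M"
  shows "(\<Sum>n\<in>{N<..M}. 1 / real n ^ s) \<le> 1 / real N ^ (s - 1)"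
proof -
  have sq: "(\<Sum>n\<in>{N<..M}. 1 / real n ^ 2) \<le> 1 / real N - 1 / real M"
    using N(2)
  proof (induction M rule: dec_induct)
    case base
    then show ?case by simp
  next
    case (step M)
    have ins: "{N<..Suc M} = insert (Suc M) {N<..M}" using step.hyps by auto
    have M0: "real M > 0" using step.hyps N(1) by simp
    have "1 / real (Suc M) ^ 2 \<le> 1 / (real M * real (Suc M))"
      using M0 by (intro divide_left_mono) (auto simp: power2_eq_square)
    also have "\<dots> = 1 / real M - 1 / real (Suc M)"
      using M0 by (simp add: field_simps)
    finally show ?case using step.IH unfolding ins by simp
  qed
  have "(\<Sum>n\<in>{N<..M}. 1 / real n ^ s) \<le> (\<Sum>n\<in>{N<..M}. 1 / real N ^ (s - 2) * (1 / real n ^ 2))"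
  proof (rule sum_mono)
    fix n assume "n \<in> {N<..M}"
    then have n: "real N \<le> real n" "real n > 0" by auto
    have "s = (s - 2) + 2" using s by simp
    then have "real n ^ s = real n ^ (s - 2) * real n ^ 2" by (metis power_add)
    then have "1 / real n ^ s = 1 / real n ^ (s - 2) * (1 / real n ^ 2)" by simp
    also have "\<dots> \<le> 1 / real N ^ (s - 2) * (1 / real n ^ 2)"
      using n N(1) by (intro mult_right_mono divide_left_mono power_mono) auto
    finally show "1 / real n ^ s \<le> 1 / real N ^ (s - 2) * (1 / real n ^ 2)" .
  qed
  also have "\<dots> = 1 / real N ^ (s - 2) * (\<Sum>n\<in>{N<..M}. 1 / real n ^ 2)"
    by (simp only: sum_distrib_left)
  also have "\<dots> \<le> 1 / real N ^ (s - 2) * (1 / real N)"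
  proof (rule mult_left_mono)
    show "(\<Sum>n\<in>{N<..M}. 1 / real n ^ 2) \<le> 1 / real N"
      by (rule order_trans[OF sq]) simp
  qed simp
  also have "\<dots> = 1 / real N ^ (s - 1)"
  proof -
    have "s - 1 = Suc (s - 2)" using s by simp
    then show ?thesis by simp
  qed
  finally show ?thesis .
qed

lemma sum_inverse_power_le:
  assumes "s \<ge> 2"
  shows "(\<Sum>n=1..N. 1 / real n ^ s) \<le> 2"
proof (cases "N \<ge> 1")
  case True
  then have "{1..N} = insert 1 {1<..N}" by auto
  then show ?thesis using sum_inverse_power_tail[OF assms, of 1 N] True by simp
qed simp

lemma suminf_tail_bound:
  fixes f :: "nat \<Rightarrow> real"
  assumes f: "summable f" "f 0 = 0" and s: "s \<ge> 2" and N: "N \<ge> 1"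
    and bound: "\<And>n. n > N \<Longrightarrow> \<bar>f n\<bar> \<le> c * (1 / real n ^ s)" and c: "c \<ge> 0"
  shows "\<bar>suminf f - (\<Sum>n=1..N. f n)\<bar> \<le> c * (1 / real N ^ (s - 1))"
proof -
  have "(\<lambda>M. \<Sum>n\<le>M. f n) \<longlonglongrightarrow> suminf f" by (rule summable_LIMSEQ'[OF f(1)])
  then have "(\<lambda>M. \<bar>(\<Sum>n\<le>M. f n) - (\<Sum>n=1..N. f n)\<bar>) \<longlonglongrightarrow> \<bar>suminf f - (\<Sum>n=1..N. f n)\<bar>"
    by (intro tendsto_intros)
  moreover have "\<bar>(\<Sum>n\<le>M. f n) - (\<Sum>n=1..N. f n)\<bar> \<le> c * (1 / real N ^ (s - 1))" if M: "M \<ge> N" for M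
  proof -
    have split: "{..M} = insert 0 ({1..N} \<union> {N<..M})" using M by auto
    have "(\<Sum>n\<le>M. f n) = f 0 + (\<Sum>n\<in>{1..N} \<union> {N<..M}. f n)"
      unfolding split by (rule sum.insert) auto
    also have "(\<Sum>n\<in>{1..N} \<union> {N<..M}. f n) = (\<Sum>n=1..N. f n) + (\<Sum>n\<in>{N<..M}. f n)"
      by (rule sum.union_disjoint) auto
    finally have "(\<Sum>n\<le>M. f n) - (\<Sum>n=1..N. f n) = (\<Sum>n\<in>{N<..M}. f n)"
      using f(2) by simp
    also have "\<bar>\<dots>\<bar> \<le> (\<Sum>n\<in>{N<..M}. c * (1 / real n ^ s))"
      by (rule order_trans[OF sum_abs]) (intro sum_mono, use bound in auto)
    also have "\<dots> = c * (\<Sum>n\<in>{N<..M}. 1 / real n ^ s)" by (simp only: sum_distrib_left)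
    also have "\<dots> \<le> c * (1 / real N ^ (s - 1))"
      by (intro mult_left_mono sum_inverse_power_tail s N M c)
    finally show ?thesis .
  qed
  ultimately show ?thesis
    by (intro Lim_bounded) auto
qed

text \<open>
  Writing \<open>e = d * k\<close> for each divisor \<open>d\<close> turns the left side into part of the double sum of
  \<open>1 / (d * k) ^ s\<close> over all \<open>d, k \<le> N\<close>.
\<close>

lemma sum_divisor_count_le:
  "(\<Sum>e=1..N. real (card {d. d dvd e}) / real e ^ s) \<le> (\<Sum>k=1..N. 1 / real k ^ s) ^ 2"
proof -
  let ?S = "Sigma {1..N} (\<lambda>e. {d. d dvd e})"
  let ?j = "\<lambda>(e :: nat, d). (d, e div d)"
  let ?t = "\<lambda>(d, k). 1 / real d ^ s * (1 / real k ^ s)"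
  have "(\<Sum>e=1..N. real (card {d. d dvd e}) / real e ^ s) = (\<Sum>e=1..N. \<Sum>d | d dvd e. 1 / real e ^ s)"
    by simp
  also have "\<dots> = (\<Sum>(e, d)\<in>?S. 1 / real e ^ s)"
    by (rule sum.Sigma) auto
  also have "\<dots> = (\<Sum>z\<in>?S. ?t (?j z))"
    by (rule sum.cong) (auto elim!: dvdE simp: power_mult_distrib)
  also have "\<dots> = (\<Sum>z\<in>?j ` ?S. ?t z)"
  proof -
    have "inj_on ?j ?S"
      by (rule inj_onI) (auto elim!: dvdE)
    then show ?thesis by (simp add: sum.reindex o_def)
  qed
  also have "\<dots> \<le> (\<Sum>z\<in>{1..N} \<times> {1..N}. ?t z)"
  proof (rule sum_mono2)
    show "?j ` ?S \<subseteq> {1..N} \<times> {1..N}"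
    proof clarify
      fix e d :: nat assume e: "e \<in> {1..N}" and d: "d dvd e"
      have "1 \<le> d" "1 \<le> e div d" using e d by (auto elim!: dvdE simp: Suc_le_eq)
      moreover have "d \<le> N" using e dvd_imp_le[OF d] by simp
      moreover have "e div d \<le> N" using e div_le_dividend[of e d] by (meson atLeastAtMost_iff le_trans)
      ultimately show "d \<in> {1..N} \<and> e div d \<in> {1..N}" by simp
    qed
  qed auto
  also have "\<dots> = (\<Sum>k=1..N. 1 / real k ^ s) ^ 2"
    by (simp only: power2_eq_square sum_product sum.cartesian_product)
  finally show ?thesis .
qed

lemma sum_two_power_omega_le:
  "(\<Sum>e=1..N. 2 ^ omega e / real e ^ s) \<le> (\<Sum>k=1..N. 1 / real k ^ s) ^ 2"
proof -
  have "(\<Sum>e=1..N. 2 ^ omega e / real e ^ s) \<le> (\<Sum>e=1..N. real (card {d. d dvd e}) / real e ^ s)"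
  proof (intro sum_mono divide_right_mono)
    fix e assume "e \<in> {1..N}"
    then have "2 ^ omega e \<le> card {d. d dvd e}" by (intro two_power_omega_le) simp
    then show "2 ^ omega e \<le> real (card {d. d dvd e})" by (metis of_nat_le_iff of_nat_numeral of_nat_power)
  qed simp
  then show ?thesis using sum_divisor_count_le order_trans by blast
qed

lemma sum_inverse_max_power_le:
  assumes p: "p \<ge> 2" and b: "1 \<le> b" "b \<le> N"
  shows "(\<Sum>a=1..N. 1 / real (max a b) ^ p) \<le> 2 * (1 / real b ^ (p - 1))"
proof -
  have split: "{1..N} = {1..b} \<union> {b<..N}" using b by auto
  have "(\<Sum>a=1..N. 1 / real (max a b) ^ p)
      = (\<Sum>a=1..b. 1 / real (max a b) ^ p) + (\<Sum>a\<in>{b<..N}. 1 / real (max a b) ^ p)"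
    unfolding split by (rule sum.union_disjoint) auto
  also have "(\<Sum>a=1..b. 1 / real (max a b) ^ p) = (\<Sum>a=1..b. 1 / real b ^ p)"
    by (intro sum.cong) (auto simp: max_def)
  also have "\<dots> = 1 / real b ^ (p - 1)"
  proof -
    have "p = Suc (p - 1)" using p by simp
    then have "real b ^ p = real b * real b ^ (p - 1)" by (metis power_Suc)
    then show ?thesis using b by simp
  qed
  also have "(\<Sum>a\<in>{b<..N}. 1 / real (max a b) ^ p) = (\<Sum>a\<in>{b<..N}. 1 / real a ^ p)"
    by (intro sum.cong) (auto simp: max_def)
  also have "\<dots> \<le> 1 / real b ^ (p - 1)"
    by (rule sum_inverse_power_tail[OF p b])
  finally show ?thesis by simp
qed

text \<open>
  Among the pairs with \<open>max a b = n\<close> there are \<open>n - 1\<close> with \<open>a < b = n\<close>, contributing \<open>g p n\<close> each;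
  those with \<open>a = n\<close> contribute \<open>G p n\<close> together. This is the origin of the numerators in \<open>C_star p\<close>.
\<close>

lemma sum_max_eq_sum_G:
  "(\<Sum>a=1..N. \<Sum>b=1..N. g p b / real (max a b) ^ s)
    = (\<Sum>n=1..N. ((real n - 1) * g p n + G p n) / real n ^ s)"
proof (induction N)
  case 0
  then show ?case by simp
next
  case (Suc N)
  let ?t = "\<lambda>a b. g p b / real (max a b) ^ s"
  have "(\<Sum>a=1..Suc N. \<Sum>b=1..Suc N. t a b)
      = (\<Sum>a=1..N. \<Sum>b=1..N. t a b) + (\<Sum>a=1..N. t a (Suc N)) + (\<Sum>b=1..Suc N. t (Suc N) b)"
    for t :: "nat \<Rightarrow> nat \<Rightarrow> real"
    by (simp add: sum.distrib)
  then have "(\<Sum>a=1..Suc N. \<Sum>b=1..Suc N. ?t a b)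
      = (\<Sum>a=1..N. \<Sum>b=1..N. ?t a b) + (\<Sum>a=1..N. ?t a (Suc N)) + (\<Sum>b=1..Suc N. ?t (Suc N) b)" .
  also have "(\<Sum>a=1..N. ?t a (Suc N)) = (\<Sum>a=1..N. g p (Suc N) / real (Suc N) ^ s)"
    by (intro sum.cong) (auto simp: max_def)
  also have "\<dots> = (real (Suc N) - 1) * g p (Suc N) / real (Suc N) ^ s"
    by simp
  also have "(\<Sum>b=1..Suc N. ?t (Suc N) b) = (\<Sum>b=1..Suc N. g p b / real (Suc N) ^ s)"
    by (intro sum.cong) (auto simp: max_def)
  also have "\<dots> = G p (Suc N) / real (Suc N) ^ s"
    by (simp only: G_def sum_divide_distrib)
  finally have "(\<Sum>a=1..Suc N. \<Sum>b=1..Suc N. ?t a b)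
      = (\<Sum>a=1..N. \<Sum>b=1..N. ?t a b)
        + ((real (Suc N) - 1) * g p (Suc N) + G p (Suc N)) / real (Suc N) ^ s"
    by (simp only: add_divide_distrib add.assoc)
  also have "\<dots> = (\<Sum>n=1..Suc N. ((real n - 1) * g p n + G p n) / real n ^ s)"
    unfolding Suc.IH
    using sum.nat_ivl_Suc'[of 1 N "\<lambda>n. ((real n - 1) * g p n + G p n) / real n ^ s"]
    by (simp only: add.commute)
  finally show ?case .
qed

section \<open>Asymptotics\<close>

lemma nat_floor_bounds:
  fixes y :: real
  assumes "y \<ge> 1"
  shows "nat \<lfloor>y\<rfloor> \<ge> 1" "real (nat \<lfloor>y\<rfloor>) \<le> y" "y \<le> 2 * real (nat \<lfloor>y\<rfloor>)"
proof -
  show 1: "nat \<lfloor>y\<rfloor> \<ge> 1" using assms by (intro le_nat_floor) simp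
  show "real (nat \<lfloor>y\<rfloor>) \<le> y" using assms by (intro of_nat_floor) simp
  have "y < real (nat \<lfloor>y\<rfloor>) + 1" using assms by linarith
  then show "y \<le> 2 * real (nat \<lfloor>y\<rfloor>)" using 1 by linarith
qed

lemma inverse_power_nat_floor_le:
  fixes y :: real
  assumes "y \<ge> 1"
  shows "1 / real (nat \<lfloor>y\<rfloor>) ^ s \<le> 2 ^ s / y ^ s"
proof -
  note N = nat_floor_bounds[OF assms]
  have "y ^ s \<le> (2 * real (nat \<lfloor>y\<rfloor>)) ^ s" using N assms by (intro power_mono) auto
  then have "y ^ s \<le> 2 ^ s * real (nat \<lfloor>y\<rfloor>) ^ s" by (simp only: power_mult_distrib)
  then show ?thesis using N assms by (simp add: divide_simps mult.commute)
qed

text \<open>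
  Of the constant, \<open>4\<close> bounds the accumulated sieve errors, through \<open>(\<Sum>1 / k ^ p)\<^sup>2 \<le> 4\<close>, and \<open>2 ^ p\<close>
  comes from the tail of the series of \<open>sieve_coeff\<close> beyond \<open>\<lfloor>y\<rfloor>\<close>, where \<open>\<lfloor>y\<rfloor> \<ge> y / 2\<close>.
\<close>

theorem coprime_jordan_sum_asymptotic:
  assumes p: "p \<ge> 2" and b: "b > 0" and y: "y \<ge> 1"
  shows "\<bar>coprime_jordan_sum p b y - zeta (real p + 1) / (real p + 1) * D_star p * g p b * y ^ (p + 1)\<bar>
    \<le> (4 + 2 ^ p) * 2 ^ omega b * y ^ p"
proof -
  define N where "N = nat \<lfloor>y\<rfloor>"
  note N = nat_floor_bounds[OF y, folded N_def]
  define m where "m = totient_ratio (prime_factors b) * y ^ (p + 1) / real (p + 1)"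
  let ?h = "sieve_coeff p b"
  let ?E = "{e. 1 \<le> e \<and> real e \<le> y \<and> coprime e b}"
  let ?\<Phi> = "\<lambda>e. (-1) ^ omega e * coprime_power_sum p (prime_factors (e * b)) (y / real e)"
  let ?B = "2 ^ omega b * y ^ p"
  have E_sub: "?E \<subseteq> {1..N}" using atLeastAtMost_nat_floor[of y] y by (auto simp: N_def)
  have summand: "\<bar>?\<Phi> e - m * ?h e\<bar> \<le> ?B * (2 ^ omega e / real e ^ p)" if e: "e \<in> ?E" for e
  proof -
    have e0: "e > 0" and cop: "coprime e b" using e by auto
    let ?T = "coprime_power_sum p (prime_factors (e * b)) (y / real e)"
    let ?M = "totient_ratio (prime_factors (e * b)) * (y / real e) ^ (p + 1) / real (p + 1)"
    have "m * ?h e = (-1) ^ omega e * ?M"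
      using cop totient_ratio_mult[OF cop e0 b]
      by (simp add: m_def sieve_coeff_def power_divide mult_ac)
    then have "?\<Phi> e - m * ?h e = (-1) ^ omega e * (?T - ?M)"
      by (simp only: right_diff_distrib)
    then have "\<bar>?\<Phi> e - m * ?h e\<bar> = \<bar>?T - ?M\<bar>" by (simp only: abs_mult power_abs) simp
    also have "\<dots> \<le> 2 ^ card (prime_factors (e * b)) * (y / real e) ^ p"
      by (rule coprime_power_sum_asymptotic) (use p y in auto)
    also have "\<dots> = ?B * (2 ^ omega e / real e ^ p)"
      using omega_mult[OF cop e0 b] by (simp add: omega_def power_add power_divide)
    finally show ?thesis .
  qed
  have "\<bar>(\<Sum>e\<in>?E. ?\<Phi> e) - (\<Sum>e\<in>?E. m * ?h e)\<bar> \<le> (\<Sum>e\<in>?E. ?B * (2 ^ omega e / real e ^ p))"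
    unfolding sum_subtractf[symmetric] by (rule order_trans[OF sum_abs]) (intro sum_mono summand)
  also have "\<dots> \<le> (\<Sum>e=1..N. ?B * (2 ^ omega e / real e ^ p))"
    using E_sub y by (intro sum_mono2) auto
  also have "\<dots> = ?B * (\<Sum>e=1..N. 2 ^ omega e / real e ^ p)" by (simp only: sum_distrib_left)
  also have "\<dots> \<le> ?B * 4"
  proof (rule mult_left_mono)
    have "(\<Sum>k=1..N. 1 / real k ^ p) ^ 2 \<le> 2 ^ 2"
      by (intro power_mono sum_inverse_power_le p sum_nonneg) auto
    then show "(\<Sum>e=1..N. 2 ^ omega e / real e ^ p) \<le> 4"
      using sum_two_power_omega_le[of p N] by simp
  qed (use y in simp)
  finally have "\<bar>coprime_jordan_sum p b y - (\<Sum>e\<in>?E. m * ?h e)\<bar> \<le> ?B * 4"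
    unfolding coprime_jordan_sum_expand[OF b] .
  moreover have "(\<Sum>e\<in>?E. m * ?h e) = m * (\<Sum>e=1..N. ?h e)"
  proof -
    \<comment> \<open>The coefficients vanish at the \<open>e\<close> that are not coprime to \<open>b\<close>.\<close>
    have "(\<Sum>e\<in>?E. ?h e) = (\<Sum>e=1..N. ?h e)"
    proof (rule sum.mono_neutral_left)
      show "\<forall>e\<in>{1..N} - ?E. ?h e = 0"
        using atLeastAtMost_nat_floor[of y] y by (auto simp: N_def sieve_coeff_def)
    qed (use E_sub in auto)
    then show ?thesis by (simp only: sum_distrib_left[symmetric])
  qed
  moreover have "\<bar>m * (\<Sum>e=1..N. ?h e) - m * suminf ?h\<bar> \<le> ?B * 2 ^ p"
  proof -
    have m: "0 \<le> m" "m \<le> y ^ (p + 1)"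
    proof -
      have "totient_ratio (prime_factors b) * y ^ (p + 1) \<le> 1 * y ^ (p + 1)"
        using totient_ratio_bounds[of b] y by (intro mult_right_mono) auto
      moreover have "y ^ (p + 1) / real (p + 1) \<le> y ^ (p + 1) / 1"
        using y by (intro divide_left_mono) auto
      ultimately show "m \<le> y ^ (p + 1)"
        unfolding m_def by (smt (verit) divide_right_mono of_nat_0_le_iff div_by_1 mult_1)
      show "0 \<le> m" unfolding m_def using totient_ratio_bounds[of b] y by simp
    qed
    have "\<bar>suminf ?h - (\<Sum>e=1..N. ?h e)\<bar> \<le> 1 * (1 / real N ^ (p + 1 - 1))"
      by (rule suminf_tail_bound)
        (use p N abs_sieve_coeff_le[of p b] has_sum_suminf_inverse_power_bound(1)[OF _ abs_sieve_coeff_le] in auto)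
    then have "\<bar>(\<Sum>e=1..N. ?h e) - suminf ?h\<bar> \<le> 2 ^ p / y ^ p"
      using inverse_power_nat_floor_le[OF y, of p] by (simp add: N_def abs_minus_commute)
    then have "m * \<bar>(\<Sum>e=1..N. ?h e) - suminf ?h\<bar> \<le> y ^ (p + 1) * (2 ^ p / y ^ p)"
      using m y by (intro mult_mono) auto
    also have "\<dots> = y ^ 1 * 2 ^ p" using y by simp
    also have "\<dots> \<le> ?B * 2 ^ p"
    proof (rule mult_right_mono)
      have "1 * y ^ 1 \<le> 2 ^ omega b * y ^ p"
        using p y by (intro mult_mono power_increasing) auto
      then show "y ^ 1 \<le> ?B" by simp
    qed simp
    finally show ?thesis
      using m by (simp add: abs_mult flip: right_diff_distrib)
  qed
  moreover have "m * suminf ?h = zeta (real p + 1) / (real p + 1) * D_star p * g p b * y ^ (p + 1)"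
  proof -
    have "m * suminf ?h = (totient_ratio (prime_factors b) * suminf ?h) * y ^ (p + 1) / real (p + 1)"
      unfolding m_def by simp
    also have "\<dots> = (zeta (real p + 1) * D_star p * g p b) * y ^ (p + 1) / real (p + 1)"
      using sieve_coeff_suminf[of p b] p b by simp
    finally show ?thesis by (simp add: add.commute)
  qed
  moreover have "(4 + 2 ^ p) * 2 ^ omega b * y ^ p = ?B * 4 + ?B * 2 ^ p"
    by (simp add: algebra_simps)
  ultimately show ?thesis by linarith
qed

text \<open>
  Indexed from \<open>0\<close>, where division by zero makes the term vanish, the series needs no shift. The bound
  on the terms rests on \<open>0 \<le> g p k \<le> 1\<close>.
\<close>

lemma semi_unitary_main_series:
  defines "t \<equiv> \<lambda>p n. ((real n - 1) * g p n + G p n) / real n ^ (p + 1)"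
  assumes p: "p \<ge> 2"
  shows "summable (t p)" "t p 0 = 0" "\<And>n. \<bar>t p n\<bar> \<le> 2 * (1 / real n ^ p)"
    "C_star p = zeta (real p + 1) / (real p + 1) * D_star p * suminf (t p)"
proof -
  show t0: "t p 0 = 0" by (simp add: t_def)
  show bound: "\<bar>t p n\<bar> \<le> 2 * (1 / real n ^ p)" for n
  proof (cases "n = 0")
    case True
    then show ?thesis using t0 by simp
  next
    case False
    have g: "0 \<le> g p k" "g p k \<le> 1" for k using g_bounds[of p k] p by auto
    have G: "0 \<le> G p n" "G p n \<le> real n"
      using sum_mono[of "{1..n}" "g p" "\<lambda>_. 1"] g by (auto simp: G_def intro: sum_nonneg)
    have "(real n - 1) * g p n \<le> real n * 1"
      using g False by (intro mult_mono) auto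
    then have num: "(real n - 1) * g p n + G p n \<le> 2 * real n" using G by simp
    have num0: "0 \<le> (real n - 1) * g p n + G p n" using g G False by simp
    have "\<bar>t p n\<bar> = ((real n - 1) * g p n + G p n) / real n ^ (p + 1)"
      using num0 by (simp add: t_def)
    also have "\<dots> \<le> (2 * real n) / real n ^ (p + 1)" by (rule divide_right_mono[OF num]) simp
    also have "\<dots> = 2 * (1 / real n ^ p)" using False by simp
    finally show ?thesis .
  qed
  show sm: "summable (t p)"
  proof (rule summable_comparison_test)
    show "summable (\<lambda>n. 2 * (1 / real n ^ p))" by (intro summable_mult summable_inverse_power p)
    show "\<exists>N. \<forall>n\<ge>N. norm (t p n) \<le> 2 * (1 / real n ^ p)" using bound by simp
  qed
  have "(\<Sum>n. t p (Suc n)) = suminf (t p)" using suminf_split_head[OF sm] t0 by simp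
  moreover have "C_star p = zeta (real p + 1) / (real p + 1) * D_star p * (\<Sum>n. t p (Suc n))"
    unfolding C_star_def t_def Let_def by (rule refl)
  ultimately show "C_star p = zeta (real p + 1) / (real p + 1) * D_star p * suminf (t p)" by simp
qed

text \<open>
  The first part of the error collects the errors of \<open>coprime_jordan_sum_asymptotic\<close> over all pairs; the
  second is the tail of the series of \<open>C_star p\<close>, of size \<open>x ^ (p + 1) / x ^ (p - 1) = x ^ 2 \<le> x ^ p\<close>.
\<close>

theorem semi_unitary_power_sum_error:
  assumes p: "p \<ge> 2" and x: "x \<ge> 1"
  shows "\<bar>semi_unitary_power_sum p x - C_star p * x ^ (p + 1)\<bar>
    \<le> (2 * (4 + 2 ^ p) * (\<Sum>k=1..nat \<lfloor>x\<rfloor>. 1 / real k ^ (p - 1)) ^ 2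
        + \<bar>zeta (real p + 1) / (real p + 1) * D_star p\<bar> * 2 ^ p) * x ^ p"
proof -
  define N where "N = nat \<lfloor>x\<rfloor>"
  note N = nat_floor_bounds[OF x, folded N_def]
  define \<kappa> where "\<kappa> = zeta (real p + 1) / (real p + 1) * D_star p"
  define t where "t = (\<lambda>n. ((real n - 1) * g p n + G p n) / real n ^ (p + 1))"
  let ?H = "\<Sum>k=1..N. 1 / real k ^ (p - 1)"
  let ?A = "4 + 2 ^ p :: real"
  let ?F = "\<lambda>a b. coprime_jordan_sum p b (x / real (max a b))"
  let ?M = "\<lambda>a b. \<kappa> * g p b * (x / real (max a b)) ^ (p + 1)"
  note series = semi_unitary_main_series[OF p]
  have t: "summable t" "t 0 = 0" "\<And>n. \<bar>t n\<bar> \<le> 2 * (1 / real n ^ p)" "C_star p = \<kappa> * suminf t"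
    unfolding t_def \<kappa>_def by (fact series)+
  have F: "\<bar>?F a b - ?M a b\<bar> \<le> ?A * 2 ^ omega b * (x / real (max a b)) ^ p"
    if "a \<in> {1..N}" "b \<in> {1..N}" for a b
  proof -
    have "real (max a b) \<le> real N" "real (max a b) > 0" using that by auto
    moreover from this have "real (max a b) \<le> x" using N(2) by linarith
    ultimately have y: "x / real (max a b) \<ge> 1" by simp
    have "b > 0" using that by simp
    from coprime_jordan_sum_asymptotic[OF p this y] show ?thesis by (simp only: \<kappa>_def)
  qed
  have "\<bar>(\<Sum>a=1..N. \<Sum>b=1..N. ?F a b) - (\<Sum>a=1..N. \<Sum>b=1..N. ?M a b)\<bar>
      \<le> (\<Sum>a=1..N. \<Sum>b=1..N. ?A * 2 ^ omega b * (x / real (max a b)) ^ p)"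
    unfolding sum_subtractf[symmetric]
    by (intro order_trans[OF sum_abs] sum_mono order_trans[OF sum_abs] F)
  also have "\<dots> = ?A * x ^ p * (\<Sum>b=1..N. 2 ^ omega b * (\<Sum>a=1..N. 1 / real (max a b) ^ p))"
    by (subst sum.swap) (simp add: sum_distrib_left power_divide mult_ac)
  also have "\<dots> \<le> ?A * x ^ p * (2 * ?H ^ 2)"
  proof (rule mult_left_mono)
    have "(\<Sum>b=1..N. 2 ^ omega b * (\<Sum>a=1..N. 1 / real (max a b) ^ p))
        \<le> (\<Sum>b=1..N. 2 ^ omega b * (2 * (1 / real b ^ (p - 1))))"
      using p by (intro sum_mono mult_left_mono sum_inverse_max_power_le) auto
    also have "\<dots> = 2 * (\<Sum>b=1..N. 2 ^ omega b / real b ^ (p - 1))"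
      by (simp add: sum_distrib_left mult_ac)
    also have "\<dots> \<le> 2 * ?H ^ 2" by (intro mult_left_mono sum_two_power_omega_le) simp
    finally show "(\<Sum>b=1..N. 2 ^ omega b * (\<Sum>a=1..N. 1 / real (max a b) ^ p)) \<le> 2 * ?H ^ 2" .
  qed (use x in simp)
  finally have err1: "\<bar>semi_unitary_power_sum p x - (\<Sum>a=1..N. \<Sum>b=1..N. ?M a b)\<bar>
      \<le> ?A * x ^ p * (2 * ?H ^ 2)"
    using semi_unitary_power_sum_eq[of x p] x by (simp add: N_def)
  have "(\<Sum>a=1..N. \<Sum>b=1..N. ?M a b)
      = \<kappa> * x ^ (p + 1) * (\<Sum>a=1..N. \<Sum>b=1..N. g p b / real (max a b) ^ (p + 1))"
    by (simp only: sum_distrib_left) (simp add: power_divide mult_ac)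
  also have "\<dots> = \<kappa> * x ^ (p + 1) * (\<Sum>n=1..N. t n)"
    by (simp only: sum_max_eq_sum_G t_def)
  finally have main: "(\<Sum>a=1..N. \<Sum>b=1..N. ?M a b) = \<kappa> * x ^ (p + 1) * (\<Sum>n=1..N. t n)" .
  have "\<bar>suminf t - (\<Sum>n=1..N. t n)\<bar> \<le> 2 * (1 / real N ^ (p - 1))"
    by (rule suminf_tail_bound[OF t(1,2) p N(1) t(3)]) simp
  also have "\<dots> \<le> 2 * (2 ^ (p - 1) / x ^ (p - 1))"
    using inverse_power_nat_floor_le[OF x, of "p - 1"] by (intro mult_left_mono) (auto simp: N_def)
  finally have "\<bar>\<kappa>\<bar> * x ^ (p + 1) * \<bar>suminf t - (\<Sum>n=1..N. t n)\<bar>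
      \<le> \<bar>\<kappa>\<bar> * x ^ (p + 1) * (2 * (2 ^ (p - 1) / x ^ (p - 1)))"
    using x by (intro mult_left_mono) auto
  also have "\<dots> = \<bar>\<kappa>\<bar> * 2 ^ p * x ^ 2"
  proof -
    obtain r where r: "p = Suc r" using p by (cases p) auto
    show ?thesis using x by (simp add: r power2_eq_square)
  qed
  also have "\<dots> \<le> \<bar>\<kappa>\<bar> * 2 ^ p * x ^ p"
    using p x by (intro mult_left_mono power_increasing) auto
  finally have "\<bar>\<kappa> * x ^ (p + 1) * (suminf t - (\<Sum>n=1..N. t n))\<bar> \<le> \<bar>\<kappa>\<bar> * 2 ^ p * x ^ p"
    using x by (simp add: abs_mult)
  then have err2: "\<bar>C_star p * x ^ (p + 1) - (\<Sum>a=1..N. \<Sum>b=1..N. ?M a b)\<bar> \<le> \<bar>\<kappa>\<bar> * 2 ^ p * x ^ p"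
    unfolding main t(4) by (simp add: algebra_simps)
  have "(2 * ?A * ?H ^ 2 + \<bar>\<kappa>\<bar> * 2 ^ p) * x ^ p = ?A * x ^ p * (2 * ?H ^ 2) + \<bar>\<kappa>\<bar> * 2 ^ p * x ^ p"
    by (simp add: algebra_simps)
  then show ?thesis
    using err1 err2 unfolding N_def[symmetric] \<kappa>_def[symmetric] by linarith
qed

lemma harmonic_sum_le:
  assumes x: "x \<ge> 1"
  shows "(\<Sum>k=1..nat \<lfloor>x\<rfloor>. 1 / real k) \<le> 1 + ln x"
proof -
  note N = nat_floor_bounds[OF x]
  obtain n where n: "nat \<lfloor>x\<rfloor> = Suc n" using N(1) by (cases "nat \<lfloor>x\<rfloor>") auto
  have "harm (Suc n) - ln (real (Suc n)) \<le> harm (Suc 0) - ln (real (Suc 0))"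
    using decseqD[OF decseq_harm_diff_ln, of 0 n] by simp
  then have "(\<Sum>k=1..Suc n. 1 / real k) \<le> 1 + ln (real (Suc n))"
    by (simp add: harm_def inverse_eq_divide)
  also have "ln (real (Suc n)) \<le> ln x" using N n by (subst ln_le_cancel_iff) auto
  finally show ?thesis by (simp only: n)
qed

theorem theorem6p3:
  fixes p :: nat
  assumes "p \<ge> 2"
  shows "(\<lambda>x::real. semi_unitary_power_sum p x - C_star p * x ^ (p + 1)) \<in> O[at_top](E_star p)"
proof -
  define A where "A = 2 * (4 + 2 ^ p :: real)"
  define B where "B = \<bar>zeta (real p + 1) / (real p + 1) * D_star p\<bar> * 2 ^ p"
  have nonneg: "A \<ge> 0" "B \<ge> 0" by (simp_all add: A_def B_def)
  have "norm (semi_unitary_power_sum p x - C_star p * x ^ (p + 1)) \<le> (4 * A + B) * norm (E_star p x)"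
    if x: "x \<ge> exp 1" for x
  proof -
    \<comment> \<open>From \<open>exp 1\<close> on, \<open>ln x \<ge> 1\<close> absorbs the additive constants.\<close>
    have x1: "x \<ge> 1" using x exp_ge_add_one_self[of 1] by simp
    have lnx: "ln x \<ge> 1" using x x1 by (subst ln_ge_iff) auto
    let ?H = "\<Sum>k=1..nat \<lfloor>x\<rfloor>. 1 / real k ^ (p - 1)"
    have H0: "0 \<le> ?H" by (intro sum_nonneg) auto
    have bound: "norm (semi_unitary_power_sum p x - C_star p * x ^ (p + 1)) \<le> (A * ?H ^ 2 + B) * x ^ p"
      using semi_unitary_power_sum_error[OF assms x1] by (simp only: A_def B_def real_norm_def)
    show ?thesis
    proof (cases "p = 2")
      case True
      have "?H \<le> 1 + ln x" using harmonic_sum_le[OF x1] True by simp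
      then have "?H \<le> 2 * ln x" using lnx by linarith
      then have "?H ^ 2 \<le> (2 * ln x) ^ 2" using H0 by (rule power_mono)
      then have "A * ?H ^ 2 \<le> A * (4 * ln x ^ 2)"
        using nonneg by (intro mult_left_mono) (auto simp: power_mult_distrib)
      moreover have "B * 1 \<le> B * ln x ^ 2"
        using nonneg lnx by (intro mult_left_mono one_le_power) auto
      ultimately have "A * ?H ^ 2 + B \<le> (4 * A + B) * ln x ^ 2" by (simp add: algebra_simps)
      then have "(A * ?H ^ 2 + B) * x ^ p \<le> (4 * A + B) * ln x ^ 2 * x ^ p"
        using x1 by (intro mult_right_mono) auto
      also have "\<dots> = (4 * A + B) * norm (E_star p x)" using True by (simp add: E_star_def)
      finally show ?thesis using bound by linarith
    next
      case False
      have "?H \<le> 2" by (rule sum_inverse_power_le) (use False assms in auto)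
      then have "?H ^ 2 \<le> 2 ^ 2" using H0 by (rule power_mono)
      then have "A * ?H ^ 2 + B \<le> A * 4 + B"
        using nonneg by (intro add_right_mono mult_left_mono) auto
      then have "(A * ?H ^ 2 + B) * x ^ p \<le> (A * 4 + B) * x ^ p"
        using x1 by (intro mult_right_mono) auto
      also have "\<dots> = (4 * A + B) * norm (E_star p x)" using False x1 by (simp add: E_star_def)
      finally show ?thesis using bound by linarith
    qed
  qed
  then show ?thesis
    by (intro bigoI[where c = "4 * A + B"] eventually_at_top_linorderI[of "exp 1"])
qed

end
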